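(* Let $G$ be a finite group and let $X$, $Y$ be compact $G$-metric spaces. Then: 1. (a) $c_\infty^G(X,Y;0)=c_{\mathrm{VR}}^G(X,Y;0)$. (b) For any $\varepsilon>0$, $\;c_{\mathrm{VR}}^G(X,Y;\varepsilon)\le c_\infty^G(X,Y;\varepsilon)\le\inf_{\delta>0}\big\{c_{\mathrm{VR}}^G(X,Y;\varepsilon+\delta)+\delta\big\}.$ 2. (a) $c_{\mathrm{VR}}^G(X,Y;0)\le 2\,c_{\mathbf E}^G(X,Y;0)$. Furthermore, if $\mathrm{Sep}^G(X)>0$ and either $c_{\mathrm{VR}}^G(X,Y;0)<\mathrm{Sep}^G(X)$ or $2\,c_{\mathbf E}^G(X,Y;0)<\mathrm{Sep}^G(X)$, then $c_{\mathrm{VR}}^G(X,Y;0)=2\,c_{\mathbf E}^G(X,Y;0)$. (b) Assume $\mathrm{Sep}^G(X),\mathrm{Sep}^G(Y)>0$. For any $\varepsilon\in\big(0,\tfrac12\mathrm{Sep}^G(Y)\big]$, if either $c_{\mathrm{VR}}^G(X,Y;2\varepsilon)<\mathrm{Sep}^G(X)-2\varepsilon$ or $2\,c_{\mathbf E}^G(X,Y;\varepsilon)<\mathrm{Sep}^G(X)-2\varepsilon$, then $c_{\mathrm{VR}}^G(X,Y;2\varepsilon)=2\,c_{\mathbf E}^G(X,Y;\varepsilon)$.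
   Context: A $G$-metric space is a (nonempty) metric space with a left $G$-action $\alpha_X$ by isometries; a $G$-map is a continuous $G$-equivariant function; $\inf\emptyset=+\infty$. For $r>0$: $\mathrm{VR}^{\mathrm m}_\infty(X;r)$ is the space of finitely supported Borel probability measures on $X$ whose support has diameter $<r$, with the weak topology and push-forward $G$-action. $\mathrm{VR}(X;r)$ is the simplicial complex with vertex set $X$ whose simplices are the finite nonempty subsets of diameter $<r$, and $|\mathrm{VR}(X;r)|$ is its geometric realization, with $G$-action $g\cdot\sum u_ix_i=\sum u_i\alpha_X(g,x_i)$. The tight span of compact $X$ is $\mathbf E(X):=\{f\in\Delta(X):\text{if }g\in\Delta(X)\text{ and }g\le f\text{ then }g=f\}$, where $\Delta(X):=\{f\in L^\infty(X):f(x)+f(x')\ge d_X(x,x')\ \forall x,x'\in X\}$ ($L^\infty(X)$ = bounded real functions on $X$), with the sup-norm metric; $G$ acts by $(g\cdot f)(x)=f(\alpha_X(g^{-1},x))$ and $X$ embeds via $x\mapsto d_X(x,\cdot)$. For $r>0$, $B_r(X,\mathbf E(X)):=\{f\in\mathbf E(X):\|f-d_X(x,\cdot)\|_\infty<r\text{ for some }x\in X\}$. $G$-persistent indices: $c_\infty^G(X,Y;0)$, $c_{\mathrm{VR}}^G(X,Y;0)$, $c_{\mathbf E}^G(X,Y;0)$ are the infima of all $\eta>0$ for which there is a $G$-map from $Y$ to $\mathrm{VR}^{\mathrm m}_\infty(X;\eta)$, to $|\mathrm{VR}(X;\eta)|$, to $B_\eta(X,\mathbf E(X))$, respectively. For $\varepsilon>0$,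 $c_\infty^G(X,Y;\varepsilon)$, $c_{\mathrm{VR}}^G(X,Y;\varepsilon)$, $c_{\mathbf E}^G(X,Y;\varepsilon)$ are the infima of all $\eta>0$ for which there is a $G$-map $\mathrm{VR}^{\mathrm m}_\infty(Y;\varepsilon)\to\mathrm{VR}^{\mathrm m}_\infty(X;\varepsilon+\eta)$, $|\mathrm{VR}(Y;\varepsilon)|\to|\mathrm{VR}(X;\varepsilon+\eta)|$, $B_\varepsilon(Y,\mathbf E(Y))\to B_{\varepsilon+\eta}(X,\mathbf E(X))$, respectively. $\mathrm{Sep}^G(X):=\inf\{d_X(x,\alpha_X(g,x)):g\in G\text{ nontrivial},\ x\in X\}$, and $:=+\infty$ if $G$ is trivial. *)

theory Defs
  imports
    "HOL-Analysis.Analysis"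
    "HOL-Probability.Probability_Measure"
    "HOL-Algebra.Group_Action"
begin

section \<open>G-metric spaces and G-maps\<close>

text \<open>
  A metric space is a type of class \<open>metric_space\<close> (nonempty, like every type), and compactness is
  compactness of \<open>UNIV\<close>.
\<close>

locale G_metric_space = group_action G UNIV \<alpha>
  for G :: "('g, 'm) monoid_scheme" (structure) and \<alpha> :: "'g \<Rightarrow> 'a :: metric_space \<Rightarrow> 'a" +
  assumes isometry: "g \<in> carrier G \<Longrightarrow> dist (\<alpha> g x) (\<alpha> g y) = dist x y"

definition G_map ::
  "('g, 'm) monoid_scheme \<Rightarrow> 's topology \<Rightarrow> ('g \<Rightarrow> 's \<Rightarrow> 's) \<Rightarrow> 't topology \<Rightarrow> ('g \<Rightarrow> 't \<Rightarrow> 't) \<Rightarrow> ('s \<Rightarrow> 't) \<Rightarrow> bool"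
  where "G_map G S \<sigma> T \<tau> f \<longleftrightarrow>
    continuous_map S T f \<and> (\<forall>g\<in>carrier G. \<forall>x\<in>topspace S. f (\<sigma> g x) = \<tau> g (f x))"

definition Sep :: "('g, 'm) monoid_scheme \<Rightarrow> ('g \<Rightarrow> 'a \<Rightarrow> 'a :: metric_space) \<Rightarrow> ereal"
  where "Sep G \<alpha> = Inf {ereal (dist x (\<alpha> g x)) | g x. g \<in> carrier G \<and> g \<noteq> \<one>\<^bsub>G\<^esub>}"

section \<open>Vietoris--Rips metric thickenings\<close>

definition measure_support :: "'a :: metric_space measure \<Rightarrow> 'a set"
  where "measure_support \<mu> = {x. \<forall>U. open U \<and> x \<in> U \<longrightarrow> emeasure \<mu> U > 0}"

text \<open>
  The requirement that the support has full measure is automatic on separable (in particular,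
  compact) spaces.
\<close>

definition VRm_set :: "real \<Rightarrow> 'a :: metric_space measure set"
  where "VRm_set r = {\<mu>. prob_space \<mu> \<and> sets \<mu> = sets borel \<and> finite (measure_support \<mu>) \<and>
    emeasure \<mu> (measure_support \<mu>) = 1 \<and> diameter (measure_support \<mu>) < r}"

text \<open>
  The weak topology is the coarsest one for which integration against every bounded continuous
  function is continuous, i.e. the topology pulled back from the product topology on
  \<open>('a \<Rightarrow>\<^sub>C real) \<Rightarrow> real\<close>.
\<close>

definition VRm :: "real \<Rightarrow> 'a :: metric_space measure topology"
  where "VRm r = pullback_topology (VRm_set r)
    (\<lambda>\<mu> (f :: 'a \<Rightarrow>\<^sub>C real). integral\<^sup>L \<mu> (apply_bcontfun f)) euclidean"

definition VRm_action :: "('g \<Rightarrow> 'a \<Rightarrow> 'a) \<Rightarrow> 'g \<Rightarrow> 'a :: metric_space measure \<Rightarrow> 'a measure"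
  where "VRm_action \<alpha> g \<mu> = distr \<mu> borel (\<alpha> g)"

section \<open>Vietoris--Rips complexes\<close>

definition VR_complex :: "real \<Rightarrow> 'a :: metric_space set set"
  where "VR_complex r = {\<sigma>. finite \<sigma> \<and> \<sigma> \<noteq> {} \<and> diameter \<sigma> < r}"

text \<open>
  A point \<open>\<Sum> u\<^sub>i x\<^sub>i\<close> of the realization is represented by its barycentric coordinates, extended
  by zero to a function on all vertices.
\<close>

definition closed_simplex :: "'v set \<Rightarrow> ('v \<Rightarrow> real) set"
  where "closed_simplex \<sigma> = {u. (\<forall>x. 0 \<le> u x) \<and> (\<forall>x. x \<notin> \<sigma> \<longrightarrow> u x = 0) \<and> (\<Sum>x\<in>\<sigma>. u x) = 1}"

text \<open>
  The realization carries the coherent (CW) topology: a set is open iff its trace on every closed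
  simplex is open there. On a single closed simplex, the topology of pointwise convergence used
  here is the Euclidean one.
\<close>

definition geometric_realization :: "'v set set \<Rightarrow> ('v \<Rightarrow> real) topology"
  where "geometric_realization K = topology (\<lambda>U. U \<subseteq> (\<Union>\<sigma>\<in>K. closed_simplex \<sigma>) \<and>
    (\<forall>\<sigma>\<in>K. openin (top_of_set (closed_simplex \<sigma>)) (U \<inter> closed_simplex \<sigma>)))"

lemma openin_geometric_realization:
  "openin (geometric_realization K) U \<longleftrightarrow> U \<subseteq> (\<Union>\<sigma>\<in>K. closed_simplex \<sigma>) \<and>
    (\<forall>\<sigma>\<in>K. openin (top_of_set (closed_simplex \<sigma>)) (U \<inter> closed_simplex \<sigma>))"
proof -
  let ?P = "\<lambda>U. U \<subseteq> (\<Union>\<sigma>\<in>K. closed_simplex \<sigma>) \<and>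
    (\<forall>\<sigma>\<in>K. openin (top_of_set (closed_simplex \<sigma>)) (U \<inter> closed_simplex \<sigma>))"
  have int: "?P (S \<inter> T)" if "?P S" "?P T" for S T
  proof (intro conjI ballI)
    show "S \<inter> T \<subseteq> (\<Union>\<sigma>\<in>K. closed_simplex \<sigma>)"
      using that by blast
    fix \<sigma> assume "\<sigma> \<in> K"
    with that have "openin (top_of_set (closed_simplex \<sigma>)) (S \<inter> closed_simplex \<sigma>)"
      and "openin (top_of_set (closed_simplex \<sigma>)) (T \<inter> closed_simplex \<sigma>)"
      by simp_all
    then have "openin (top_of_set (closed_simplex \<sigma>)) ((S \<inter> closed_simplex \<sigma>) \<inter> (T \<inter> closed_simplex \<sigma>))"
      by (rule openin_Int)
    moreover have "(S \<inter> closed_simplex \<sigma>) \<inter> (T \<inter> closed_simplex \<sigma>) = S \<inter> T \<inter> closed_simplex \<sigma>"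
      by blast
    ultimately show "openin (top_of_set (closed_simplex \<sigma>)) (S \<inter> T \<inter> closed_simplex \<sigma>)"
      by simp
  qed
  have un: "?P (\<Union>\<U>)" if "\<forall>U\<in>\<U>. ?P U" for \<U>
  proof (intro conjI ballI)
    show "\<Union>\<U> \<subseteq> (\<Union>\<sigma>\<in>K. closed_simplex \<sigma>)"
      using that by blast
    fix \<sigma> assume "\<sigma> \<in> K"
    with that have "\<forall>U\<in>\<U>. openin (top_of_set (closed_simplex \<sigma>)) (U \<inter> closed_simplex \<sigma>)"
      by simp
    then have "openin (top_of_set (closed_simplex \<sigma>)) (\<Union>((\<lambda>U. U \<inter> closed_simplex \<sigma>) ` \<U>))"
      by (intro openin_Union) auto
    moreover have "\<Union>((\<lambda>U. U \<inter> closed_simplex \<sigma>) ` \<U>) = \<Union>\<U> \<inter> closed_simplex \<sigma>"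
      by blast
    ultimately show "openin (top_of_set (closed_simplex \<sigma>)) (\<Union>\<U> \<inter> closed_simplex \<sigma>)"
      by simp
  qed
  have "istopology ?P"
    unfolding istopology_def
    by (rule conjI, (intro allI impI, erule (1) int), (intro allI impI, erule un))
  then show ?thesis
    by (simp add: geometric_realization_def topology_inverse')
qed

lemma topspace_geometric_realization:
  "topspace (geometric_realization K) = (\<Union>\<sigma>\<in>K. closed_simplex \<sigma>)"
proof -
  have "(\<Union>\<sigma>\<in>K. closed_simplex \<sigma>) \<inter> closed_simplex \<tau> = closed_simplex \<tau>" if "\<tau> \<in> K" for \<tau> :: "'a set"
    using that by blast
  then have "openin (geometric_realization K) (\<Union>\<sigma>\<in>K. closed_simplex \<sigma>)"
    by (simp add: openin_geometric_realization)
  then show ?thesis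
    by (metis openin_geometric_realization openin_subset openin_topspace subset_antisym)
qed

definition VR :: "real \<Rightarrow> ('a :: metric_space \<Rightarrow> real) topology"
  where "VR r = geometric_realization (VR_complex r)"

text \<open>
  In coordinates, \<open>\<Sum> u\<^sub>i (g x\<^sub>i)\<close> has at \<open>y\<close> the sum of all \<open>u\<^sub>i\<close> with \<open>g x\<^sub>i = y\<close>.
\<close>

definition VR_action :: "('g \<Rightarrow> 'a \<Rightarrow> 'a) \<Rightarrow> 'g \<Rightarrow> ('a \<Rightarrow> real) \<Rightarrow> ('a \<Rightarrow> real)"
  where "VR_action \<alpha> g u = (\<lambda>y. \<Sum>x | u x \<noteq> 0 \<and> \<alpha> g x = y. u x)"

section \<open>Tight spans\<close>

definition Linf :: "('a \<Rightarrow> real) metric"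
  where "Linf = funspace UNIV euclidean_metric"

definition \<Delta>_set :: "('a :: metric_space \<Rightarrow> real) set"
  where "\<Delta>_set = {f \<in> mspace Linf. \<forall>x x'. f x + f x' \<ge> dist x x'}"

definition tight_span :: "('a :: metric_space \<Rightarrow> real) set"
  where "tight_span = {f \<in> \<Delta>_set. \<forall>g\<in>\<Delta>_set. g \<le> f \<longrightarrow> g = f}"

text \<open>
  Only meaningful on bounded (e.g. compact) spaces: there \<open>dist x\<close> is a bounded function, and
  \<open>mdist Linf\<close> is the sup-distance on bounded functions but \<open>0\<close> elsewhere.
\<close>

definition tight_span_nbhd :: "real \<Rightarrow> ('a :: metric_space \<Rightarrow> real) topology"
  where "tight_span_nbhd r =
    subtopology (mtopology_of Linf) {f \<in> tight_span. \<exists>x. mdist Linf f (dist x) < r}"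

definition tight_span_action ::
  "('g, 'm) monoid_scheme \<Rightarrow> ('g \<Rightarrow> 'a \<Rightarrow> 'a) \<Rightarrow> 'g \<Rightarrow> ('a \<Rightarrow> real) \<Rightarrow> ('a \<Rightarrow> real)"
  where "tight_span_action G \<alpha> g f = (\<lambda>x. f (\<alpha> (inv\<^bsub>G\<^esub> g) x))"

section \<open>G-persistent indices\<close>

definition G_index ::
  "('g, 'm) monoid_scheme \<Rightarrow> 's topology \<Rightarrow> ('g \<Rightarrow> 's \<Rightarrow> 's) \<Rightarrow> (real \<Rightarrow> 't topology) \<Rightarrow> ('g \<Rightarrow> 't \<Rightarrow> 't) \<Rightarrow> real \<Rightarrow> ereal"
  where "G_index G S \<sigma> T \<tau> \<epsilon> = Inf {ereal \<eta> | \<eta>. \<eta> > 0 \<and> (\<exists>f. G_map G S \<sigma> (T (\<epsilon> + \<eta>)) \<tau> f)}"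

definition c_infty ::
  "('g, 'm) monoid_scheme \<Rightarrow> ('g \<Rightarrow> 'a \<Rightarrow> 'a :: metric_space) \<Rightarrow> ('g \<Rightarrow> 'b \<Rightarrow> 'b :: metric_space) \<Rightarrow> real \<Rightarrow> ereal"
  where "c_infty G \<alpha>X \<alpha>Y \<epsilon> =
    (if \<epsilon> = 0 then G_index G euclidean \<alpha>Y VRm (VRm_action \<alpha>X) 0
     else G_index G (VRm \<epsilon>) (VRm_action \<alpha>Y) VRm (VRm_action \<alpha>X) \<epsilon>)"

definition c_VR ::
  "('g, 'm) monoid_scheme \<Rightarrow> ('g \<Rightarrow> 'a \<Rightarrow> 'a :: metric_space) \<Rightarrow> ('g \<Rightarrow> 'b \<Rightarrow> 'b :: metric_space) \<Rightarrow> real \<Rightarrow> ereal"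
  where "c_VR G \<alpha>X \<alpha>Y \<epsilon> =
    (if \<epsilon> = 0 then G_index G euclidean \<alpha>Y VR (VR_action \<alpha>X) 0
     else G_index G (VR \<epsilon>) (VR_action \<alpha>Y) VR (VR_action \<alpha>X) \<epsilon>)"

definition c_E ::
  "('g, 'm) monoid_scheme \<Rightarrow> ('g \<Rightarrow> 'a \<Rightarrow> 'a :: metric_space) \<Rightarrow> ('g \<Rightarrow> 'b \<Rightarrow> 'b :: metric_space) \<Rightarrow> real \<Rightarrow> ereal"
  where "c_E G \<alpha>X \<alpha>Y \<epsilon> =
    (if \<epsilon> = 0 then G_index G euclidean \<alpha>Y tight_span_nbhd (tight_span_action G \<alpha>X) 0
     else G_index G (tight_span_nbhd \<epsilon>) (tight_span_action G \<alpha>Y)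
       tight_span_nbhd (tight_span_action G \<alpha>X) \<epsilon>)"

end

theory Submission
  imports Defs
begin

text \<open>
  An inequality between two indices is proved by composing a given \<open>G\<close>-map with fixed \<open>G\<close>-maps
  between the three kinds of thickening of one space, and the change of scale under the fixed maps is
  the change in the bound. Four fixed maps are enough. All of them are given by formulas in terms of
  distances and of finite invariant sets, so that they are equivariant.
  
  \<^item> From the Vietoris--Rips complex to the metric thickening, at the same scale: barycentric
    coordinates are the masses of an atomic measure (\<open>G_map_VR_VRm\<close>).
  \<^item> From the metric thickening to the complex, at a cost of any \<open>\<delta> > 0\<close>: the mass of a measure is
    distributed over the points of a finite invariant \<open>\<delta>/2\<close>-net (\<open>ex_G_map_VRm_VR\<close>). These two maps
    yield the comparison of the indices of the complex and of the metric thickening.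
  \<^item> From the \<open>r\<close>-neighbourhood in the tight span to the complex at scale \<open>2 r\<close>: a function \<open>f\<close> gives
    weights to points \<open>x\<close> with \<open>f x < r\<close>, and two such points satisfy
    \<open>dist x x' \<le> f x + f x' < 2 r\<close> (\<open>ex_G_map_tight_span_nbhd_VR\<close>).
  \<^item> From the complex at scale \<open>2 r\<close> to the \<open>r\<close>-neighbourhood in the tight span
    (\<open>ex_G_map_VR_tight_span_nbhd\<close>).
  
  The last map is the delicate one: mixing the functions \<open>dist x\<close> with the barycentric coordinates as
  weights lands in the neighbourhood of radius \<open>2 r\<close> only. Instead, coordinates \<open>u\<close> are turned into a
  function that has a deep valley at each vertex, the deeper the larger the coordinate, and this
  function is raised by the smallest constant that brings it into \<open>\<Delta>_set\<close>. The constant is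
  controlled by half the distances between the vertices in the support, and at the vertex with the
  largest coordinate the resulting value is at most half the diameter of the support, hence below
  \<open>r\<close>. An equivariant nonexpansive retraction of \<open>\<Delta>_set\<close> onto the tight span that only decreases
  functions (\<open>tight_retract\<close>) then finishes the construction.
  
  As the last two maps convert radius \<open>r\<close> into scale exactly \<open>2 r\<close> and back, the index of the complex
  at \<open>2 \<epsilon>\<close> is twice the index of the tight span at \<open>\<epsilon>\<close>.
\<close>

section \<open>Isometric actions and equivariant maps\<close>

lemma G_map_comp:
  assumes "G_map G S \<sigma> T \<tau> f" and "G_map G T \<tau> U \<upsilon> h"
  shows "G_map G S \<sigma> U \<upsilon> (h \<circ> f)"
proof -
  have "f x \<in> topspace T" if "x \<in> topspace S" for x
    using assms(1) that by (auto simp: G_map_def continuous_map_def)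
  then show ?thesis
    using assms by (auto simp: G_map_def intro: continuous_map_compose)
qed

text \<open>
  A finite set attains its diameter, so the strict bound passes to the diameter.
\<close>

lemma diameter_less_iff:
  assumes "finite \<sigma>" and "\<sigma> \<noteq> {}"
  shows "diameter \<sigma> < r \<longleftrightarrow> (\<forall>x\<in>\<sigma>. \<forall>y\<in>\<sigma>. dist x y < r)"
proof
  assume "diameter \<sigma> < r"
  then show "\<forall>x\<in>\<sigma>. \<forall>y\<in>\<sigma>. dist x y < r"
    using diameter_bounded_bound[OF finite_imp_bounded[OF assms(1)]] by (meson le_less_trans)
next
  assume "\<forall>x\<in>\<sigma>. \<forall>y\<in>\<sigma>. dist x y < r"
  then show "diameter \<sigma> < r"
    using diameter_compact_attained[OF finite_imp_compact[OF assms(1)] assms(2)] by metis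
qed

context G_metric_space
begin

lemma group_G: "group G"
  using group_hom by (rule group_hom.axioms(1))

lemma inv_carrier [simp]: "g \<in> carrier G \<Longrightarrow> inv g \<in> carrier G"
  by (rule group.inv_closed[OF group_G])

lemma inv_inv_carrier [simp]: "g \<in> carrier G \<Longrightarrow> inv (inv g) = g"
  by (rule group.inv_inv[OF group_G])

lemma act_inv_act [simp]: "g \<in> carrier G \<Longrightarrow> \<alpha> (inv g) (\<alpha> g x) = x"
  by (rule orbit_sym_aux) simp_all

lemma act_act_inv [simp]: "g \<in> carrier G \<Longrightarrow> \<alpha> g (\<alpha> (inv g) x) = x"
  using act_inv_act[of "inv g" x] by simp

lemma act_one [simp]: "\<alpha> \<one> x = x"
  using fun_cong[OF id_eq_one, of x] by simp

lemma act_eq_iff: "g \<in> carrier G \<Longrightarrow> \<alpha> g x = y \<longleftrightarrow> x = \<alpha> (inv g) y"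
  by (metis act_inv_act act_act_inv)

lemma surj_act: "g \<in> carrier G \<Longrightarrow> surj (\<alpha> g)"
  using surj_prop by simp

lemma inj_act: "g \<in> carrier G \<Longrightarrow> inj (\<alpha> g)"
  using inj_prop by simp

lemma dist_act_inv: "g \<in> carrier G \<Longrightarrow> dist (\<alpha> (inv g) x) y = dist x (\<alpha> g y)"
  using isometry[of g "\<alpha> (inv g) x" y] by simp

lemma continuous_act: "g \<in> carrier G \<Longrightarrow> continuous_on UNIV (\<alpha> g)"
  by (intro lipschitz_on_continuous_on[of 1] lipschitz_onI) (simp_all add: isometry)

lemma VR_action_apply:
  assumes "g \<in> carrier G"
  shows "VR_action \<alpha> g u y = u (\<alpha> (inv g) y)"
proof -
  have "{x. u x \<noteq> 0 \<and> \<alpha> g x = y} = {x. x = \<alpha> (inv g) y \<and> u x \<noteq> 0}"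
    by (simp only: act_eq_iff[OF assms] conj_commute)
  also have "\<dots> = (if u (\<alpha> (inv g) y) \<noteq> 0 then {\<alpha> (inv g) y} else {})"
    by (rule Collect_conv_if)
  finally show ?thesis
    by (simp add: VR_action_def)
qed

end

section \<open>Maps into and out of a geometric realization\<close>

lemma closed_closed_simplex:
  fixes \<sigma> :: "'v set"
  shows "closed (closed_simplex \<sigma>)"
proof -
  have coord: "continuous_on UNIV (\<lambda>u :: 'v \<Rightarrow> real. u x)" for x :: 'v
    by (rule continuous_on_product_coordinates)
  have "closed_simplex \<sigma> = (\<Inter>x. {u. 0 \<le> u x}) \<inter> (\<Inter>x\<in>-\<sigma>. {u. u x = 0}) \<inter> {u. (\<Sum>x\<in>\<sigma>. u x) = 1}"
    unfolding closed_simplex_def by blast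
  moreover have "closed (\<Inter>x. {u :: 'v \<Rightarrow> real. 0 \<le> u x})"
    by (intro closed_INT ballI closed_Collect_le continuous_on_const coord)
  moreover have "closed (\<Inter>x\<in>-\<sigma>. {u :: 'v \<Rightarrow> real. u x = 0})"
    by (intro closed_INT ballI closed_Collect_eq continuous_on_const coord)
  moreover have "closed {u :: 'v \<Rightarrow> real. (\<Sum>x\<in>\<sigma>. u x) = 1}"
    by (intro closed_Collect_eq continuous_on_const continuous_on_sum coord)
  ultimately show ?thesis
    by (metis closed_Int)
qed

text \<open>
  The coherent topology is finer than the topology of pointwise convergence, but the two agree on a
  subcomplex with finitely many vertices, because there the complement of an open set is a finite
  union of closed subsets of simplices. So locally finite supports make coordinatewise continuity
  sufficient.
\<close>

lemma continuous_map_into_realization: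
  assumes simp: "\<And>s. s \<in> topspace S \<Longrightarrow> {v. F s v \<noteq> 0} \<in> K"
    and bary: "\<And>s. s \<in> topspace S \<Longrightarrow> F s \<in> closed_simplex {v. F s v \<noteq> 0}"
    and cont: "\<And>v. continuous_map S euclideanreal (\<lambda>s. F s v)"
    and loc: "\<And>s. s \<in> topspace S \<Longrightarrow>
      \<exists>V N. openin S V \<and> s \<in> V \<and> finite N \<and> (\<forall>t\<in>V. {v. F t v \<noteq> 0} \<subseteq> N)"
  shows "continuous_map S (geometric_realization K) F"
proof -
  have "continuous_map S euclidean F"
    by (simp add: euclidean_product_topology[symmetric] continuous_map_componentwise_UNIV cont)
  have "openin S {s \<in> topspace S. F s \<in> U}" if U: "openin (geometric_realization K) U" for U
  proof (subst openin_subopen, clarify)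
    fix s assume s: "s \<in> topspace S" "F s \<in> U"
    obtain V N where V: "openin S V" "s \<in> V" and "finite N"
      and N: "\<And>t. t \<in> V \<Longrightarrow> {v. F t v \<noteq> 0} \<subseteq> N"
      using loc[OF s(1)] by blast
    define C where "C = (\<Union>\<sigma>\<in>{\<sigma>\<in>K. \<sigma> \<subseteq> N}. (closed_simplex \<sigma> - U))"
    have "closed (closed_simplex \<sigma> - U)" if "\<sigma> \<in> K" for \<sigma>
    proof -
      have "openin (top_of_set (closed_simplex \<sigma>)) (U \<inter> closed_simplex \<sigma>)"
        using U that by (simp add: openin_geometric_realization)
      then have "closedin (top_of_set (closed_simplex \<sigma>)) (closed_simplex \<sigma> - U \<inter> closed_simplex \<sigma>)"
        by (simp add: openin_closedin_eq)
      moreover have "closed_simplex \<sigma> - U \<inter> closed_simplex \<sigma> = closed_simplex \<sigma> - U"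
        by blast
      ultimately show ?thesis
        using closedin_closed_trans closed_closed_simplex by metis
    qed
    moreover have "finite {\<sigma>\<in>K. \<sigma> \<subseteq> N}"
      using \<open>finite N\<close> by (rule finite_subset[rotated, OF finite_Pow_iff[THEN iffD2]]) auto
    ultimately have "closed C"
      unfolding C_def by (intro closed_UN) simp_all
    then have "openin S {t \<in> topspace S. F t \<in> - C}"
      using \<open>continuous_map S euclidean F\<close> by (intro openin_continuous_map_preimage) auto
    then have "openin S (V \<inter> {t \<in> topspace S. F t \<in> - C})"
      using V by blast
    moreover have "s \<in> V \<inter> {t \<in> topspace S. F t \<in> - C}"
      using V s by (auto simp: C_def)
    moreover have "F t \<in> U" if t: "t \<in> V" "t \<in> topspace S" "F t \<notin> C" for t
      using t simp[of t] bary[of t] N[of t] unfolding C_def by blast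
    ultimately show "\<exists>T. openin S T \<and> s \<in> T \<and> T \<subseteq> {s \<in> topspace S. F s \<in> U}"
      by blast
  qed
  moreover have "F s \<in> topspace (geometric_realization K)" if "s \<in> topspace S" for s
    using simp[OF that] bary[OF that] by (auto simp: topspace_geometric_realization)
  ultimately show ?thesis
    by (auto simp: continuous_map_def)
qed

lemma continuous_map_from_realization:
  assumes "\<And>\<sigma>. \<sigma> \<in> K \<Longrightarrow> continuous_map (top_of_set (closed_simplex \<sigma>)) T f"
  shows "continuous_map (geometric_realization K) T f"
proof -
  have "openin (geometric_realization K) {u \<in> topspace (geometric_realization K). f u \<in> U}"
    if "openin T U" for U
  proof -
    have "openin (top_of_set (closed_simplex \<sigma>))
            ({u \<in> topspace (geometric_realization K). f u \<in> U} \<inter> closed_simplex \<sigma>)" if "\<sigma> \<in> K" for \<sigma>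
    proof -
      have "{u \<in> topspace (geometric_realization K). f u \<in> U} \<inter> closed_simplex \<sigma> =
          {u \<in> topspace (top_of_set (closed_simplex \<sigma>)). f u \<in> U}"
        using that by (auto simp: topspace_geometric_realization)
      then show ?thesis
        using openin_continuous_map_preimage[OF assms[OF that] \<open>openin T U\<close>] by simp
    qed
    then show ?thesis
      by (auto simp: openin_geometric_realization topspace_geometric_realization)
  qed
  moreover have "f u \<in> topspace T" if "u \<in> topspace (geometric_realization K)" for u
    using that assms by (fastforce simp: topspace_geometric_realization continuous_map_def Pi_iff)
  ultimately show ?thesis
    by (auto simp: continuous_map_def)
qed

definition normalized :: "('v \<Rightarrow> real) \<Rightarrow> 'v \<Rightarrow> real"
  where "normalized w = (\<lambda>v. w v / (\<Sum>x | w x \<noteq> 0. w x))"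

text \<open>
  Both maps into the Vietoris--Rips complex are built from this criterion: a partition of unity up to
  normalization, equivariant in the parameter and in the vertex, maps to the complex as soon as points
  that carry weight simultaneously are less than \<open>r\<close> apart.
\<close>

lemma (in G_metric_space) G_map_to_VR:
  fixes F :: "'s \<Rightarrow> 'a \<Rightarrow> real"
  assumes nonneg: "\<And>s v. s \<in> topspace S \<Longrightarrow> 0 \<le> F s v"
    and nonzero: "\<And>s. s \<in> topspace S \<Longrightarrow> \<exists>v. F s v \<noteq> 0"
    and near: "\<And>s v v'. s \<in> topspace S \<Longrightarrow> F s v \<noteq> 0 \<Longrightarrow> F s v' \<noteq> 0 \<Longrightarrow> dist v v' < r"
    and cont: "\<And>v. continuous_map S euclideanreal (\<lambda>s. F s v)"
    and loc: "\<And>s. s \<in> topspace S \<Longrightarrow>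
      \<exists>V N. openin S V \<and> s \<in> V \<and> finite N \<and> (\<forall>t\<in>V. {v. F t v \<noteq> 0} \<subseteq> N)"
    and equivariant: "\<And>g s v. g \<in> carrier G \<Longrightarrow> s \<in> topspace S \<Longrightarrow> F (\<sigma> g s) v = F s (\<alpha> (inv g) v)"
  shows "G_map G S \<sigma> (VR r) (VR_action \<alpha>) (\<lambda>s. normalized (F s))"
proof -
  have fin: "finite {v. F s v \<noteq> 0}" if "s \<in> topspace S" for s
    using loc[OF that] by (meson finite_subset)
  have total: "(\<Sum>x | F s x \<noteq> 0. F s x) > 0" if "s \<in> topspace S" for s
    by (rule sum_pos) (use that fin nonzero nonneg in \<open>auto simp: less_le\<close>)
  have supp: "{v. normalized (F s) v \<noteq> 0} = {v. F s v \<noteq> 0}" if "s \<in> topspace S" for s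
    using total[OF that] by (auto simp: normalized_def)
  have "continuous_map S (geometric_realization (VR_complex r)) (\<lambda>s. normalized (F s))"
  proof (rule continuous_map_into_realization)
    fix s assume s: "s \<in> topspace S"
    show "{v. normalized (F s) v \<noteq> 0} \<in> VR_complex r"
      unfolding supp[OF s] VR_complex_def
      using fin[OF s] nonzero[OF s] near[OF s] by (auto simp: diameter_less_iff)
    have "(\<Sum>x | F s x \<noteq> 0. normalized (F s) x) = 1"
      using total[OF s] by (simp add: normalized_def flip: sum_divide_distrib)
    then show "normalized (F s) \<in> closed_simplex {v. normalized (F s) v \<noteq> 0}"
      unfolding supp[OF s] closed_simplex_def
      using total[OF s] nonneg[OF s] by (auto simp: normalized_def)
    show "\<exists>V N. openin S V \<and> s \<in> V \<and> finite N \<and> (\<forall>t\<in>V. {v. normalized (F t) v \<noteq> 0} \<subseteq> N)"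
    proof -
      obtain V N where V: "openin S V" "s \<in> V" and N: "finite N" "\<forall>t\<in>V. {v. F t v \<noteq> 0} \<subseteq> N"
        using loc[OF s] by blast
      have "\<forall>t\<in>V. {v. normalized (F t) v \<noteq> 0} \<subseteq> N"
      proof
        fix t assume "t \<in> V"
        with openin_subset[OF V(1)] have "t \<in> topspace S" by blast
        then show "{v. normalized (F t) v \<noteq> 0} \<subseteq> N"
          using N(2) \<open>t \<in> V\<close> by (simp only: supp)
      qed
      with V N(1) show ?thesis by blast
    qed
  next
    fix v
    obtain V N where VN: "\<And>s. s \<in> topspace S \<Longrightarrow>
        openin S (V s) \<and> s \<in> V s \<and> finite (N s) \<and> (\<forall>t\<in>V s. {v. F t v \<noteq> 0} \<subseteq> N s)"
      using loc by metis
    show "continuous_map S euclideanreal (\<lambda>s. normalized (F s) v)"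
    proof (rule pasting_lemma[where I = "topspace S" and T = V])
      fix s assume s: "s \<in> topspace S"
      have eq: "(\<Sum>x | F t x \<noteq> 0. F t x) = (\<Sum>x\<in>N s. F t x)" if "t \<in> V s" for t
        by (rule sum.mono_neutral_left) (use VN[OF s] that in auto)
      have "continuous_map (subtopology S (V s)) euclideanreal (\<lambda>t. F t v / (\<Sum>x\<in>N s. F t x))"
      proof (intro continuous_map_real_divide continuous_map_sum continuous_map_from_subtopology cont)
        fix t assume "t \<in> topspace (subtopology S (V s))"
        then show "(\<Sum>x\<in>N s. F t x) \<noteq> 0"
          using total[of t] eq[of t] by auto
      qed (use VN[OF s] in auto)
      then show "continuous_map (subtopology S (V s)) euclideanreal (\<lambda>t. normalized (F t) v)"
        by (rule continuous_map_eq) (auto simp: normalized_def eq)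
    qed (use VN in auto)
  qed
  moreover have "normalized (F (\<sigma> g s)) = VR_action \<alpha> g (normalized (F s))"
    if g: "g \<in> carrier G" and s: "s \<in> topspace S" for g s
  proof
    fix v
    have "(\<Sum>x | F s (\<alpha> (inv g) x) \<noteq> 0. F s (\<alpha> (inv g) x)) = (\<Sum>x | F s x \<noteq> 0. F s x)"
      by (rule sum.reindex_bij_witness[where i = "\<alpha> g" and j = "\<alpha> (inv g)"]) (use g in auto)
    then show "normalized (F (\<sigma> g s)) v = VR_action \<alpha> g (normalized (F s)) v"
      using g s by (simp add: VR_action_apply normalized_def equivariant)
  qed
  ultimately show ?thesis
    by (simp add: G_map_def VR_def)
qed

section \<open>Finitely supported measures as points of the complex\<close>

lemma VR_topspaceD:
  assumes "u \<in> topspace (VR r)"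
  shows "0 \<le> u x" and "finite {x. u x \<noteq> 0}" and "{x. u x \<noteq> 0} \<noteq> {}"
    and "(\<Sum>x | u x \<noteq> 0. u x) = 1" and "diameter {x. u x \<noteq> 0} < r"
proof -
  obtain \<sigma> where \<sigma>: "finite \<sigma>" "diameter \<sigma> < r" and u: "u \<in> closed_simplex \<sigma>"
    using assms by (auto simp: VR_def topspace_geometric_realization VR_complex_def)
  then show "0 \<le> u x"
    by (simp add: closed_simplex_def)
  have sub: "{x. u x \<noteq> 0} \<subseteq> \<sigma>"
    using u by (auto simp: closed_simplex_def)
  then show "finite {x. u x \<noteq> 0}"
    using \<sigma>(1) by (rule finite_subset)
  have "(\<Sum>x | u x \<noteq> 0. u x) = (\<Sum>x\<in>\<sigma>. u x)"
    by (rule sum.mono_neutral_left) (use \<sigma>(1) sub in auto)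
  with u show total: "(\<Sum>x | u x \<noteq> 0. u x) = 1"
    by (simp add: closed_simplex_def)
  show "{x. u x \<noteq> 0} \<noteq> {}"
  proof
    assume empty: "{x. u x \<noteq> 0} = {}"
    show False
      using total unfolding empty by simp
  qed
  have "diameter {x. u x \<noteq> 0} \<le> diameter \<sigma>"
    using sub finite_imp_bounded[OF \<sigma>(1)] by (rule diameter_subset)
  with \<sigma>(2) show "diameter {x. u x \<noteq> 0} < r"
    by simp
qed

text \<open>
  The union of the finitely many translates of a finite net is again finite, and it is invariant.
\<close>

lemma (in G_metric_space) ex_invariant_net:
  assumes "finite (carrier G)" and "compact (UNIV :: 'a set)" and "0 < e"
  shows "\<exists>N. finite N \<and> (\<forall>g\<in>carrier G. \<forall>x\<in>N. \<alpha> g x \<in> N) \<and> (\<forall>y. \<exists>x\<in>N. dist x y < e)"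
proof -
  obtain K :: "'a set" where K: "finite K" "UNIV \<subseteq> (\<Union>x\<in>K. ball x e)"
    using compact_eq_totally_bounded[THEN iffD1, OF assms(2)] assms(3) by auto
  define N where "N = (\<Union>g\<in>carrier G. \<alpha> g ` K)"
  have "finite N"
    using K(1) assms(1) by (simp add: N_def)
  moreover have "\<alpha> g x \<in> N" if g: "g \<in> carrier G" and x: "x \<in> N" for g x
  proof -
    obtain h k where h: "h \<in> carrier G" "k \<in> K" "x = \<alpha> h k"
      using x by (auto simp: N_def)
    have "g \<otimes> h \<in> carrier G"
      using group_G g h(1) by (meson group.is_monoid monoid.m_closed)
    moreover have "\<alpha> g x = \<alpha> (g \<otimes> h) k"
      using g h by (simp add: composition_rule)
    ultimately show ?thesis
      using h(2) by (auto simp: N_def)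
  qed
  moreover have "\<exists>x\<in>N. dist x y < e" for y
  proof -
    obtain x where "x \<in> K" "dist x y < e"
      using K(2) by (auto simp: subset_iff)
    moreover have "\<one> \<in> carrier G"
      using group_G by (meson group.is_monoid monoid.one_closed)
    moreover from this have "x \<in> \<alpha> \<one> ` K"
      using \<open>x \<in> K\<close> by (simp add: image_iff)
    ultimately show ?thesis
      unfolding N_def by blast
  qed
  ultimately show ?thesis
    by blast
qed

text \<open>
  This is \<open>\<Sum> u\<^sub>i \<delta>\<^sub>x\<^sub>i\<close> for the point \<open>\<Sum> u\<^sub>i x\<^sub>i\<close> of the realization. It is a push-forward along the identity
  because \<open>point_measure\<close> measures all subsets of its carrier, while a Borel measure on the
  whole space is needed.
\<close>

definition atomic_measure :: "('a :: metric_space \<Rightarrow> real) \<Rightarrow> 'a measure"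
  where "atomic_measure u = distr (point_measure {x. u x \<noteq> 0} (\<lambda>x. ennreal (u x))) borel (\<lambda>x. x)"

lemma sets_atomic_measure [simp]: "sets (atomic_measure u) = sets borel"
  by (simp add: atomic_measure_def)

lemma space_atomic_measure [simp]: "space (atomic_measure u) = UNIV"
  by (simp add: atomic_measure_def)

lemma emeasure_atomic_measure:
  assumes "finite {x. u x \<noteq> 0}" and "A \<in> sets borel"
  shows "emeasure (atomic_measure u) A = (\<Sum>x | u x \<noteq> 0 \<and> x \<in> A. ennreal (u x))"
proof -
  have "(\<lambda>x. x) -` A \<inter> {x. u x \<noteq> 0} = {x. u x \<noteq> 0 \<and> x \<in> A}"
    by auto
  then show ?thesis
    using assms unfolding atomic_measure_def
    by (simp add: emeasure_distr space_point_measure emeasure_point_measure_finite Collect_mono)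
qed

lemma integral_atomic_measure:
  fixes f :: "'a :: metric_space \<Rightarrow> real"
  assumes "finite {x. u x \<noteq> 0}" and "\<And>x. 0 \<le> u x" and "f \<in> borel_measurable borel"
  shows "integral\<^sup>L (atomic_measure u) f = (\<Sum>x | u x \<noteq> 0. u x * f x)"
  using assms unfolding atomic_measure_def
  by (subst integral_distr) (auto simp: lebesgue_integral_point_measure_finite)

lemma measure_support_atomic_measure:
  assumes "finite {x. u x \<noteq> 0}" and "\<And>x. 0 \<le> u x"
  shows "measure_support (atomic_measure u) = {x. u x \<noteq> 0}"
proof (intro Set.set_eqI iffI)
  fix x assume x: "x \<in> measure_support (atomic_measure u)"
  have "open (- {y. u y \<noteq> 0})"
    using finite_imp_closed[OF assms(1)] by (simp add: open_Compl)
  moreover from this have "emeasure (atomic_measure u) (- {y. u y \<noteq> 0}) = 0"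
    by (subst emeasure_atomic_measure[OF assms(1)]) auto
  ultimately show "x \<in> {y. u y \<noteq> 0}"
    using x unfolding measure_support_def by fastforce
next
  fix x assume x: "x \<in> {y. u y \<noteq> 0}"
  have "emeasure (atomic_measure u) U > 0" if U: "open U" "x \<in> U" for U
  proof -
    have "0 < ennreal (u x)"
      using x assms(2)[of x] by (auto simp: less_le)
    also have "ennreal (u x) \<le> (\<Sum>y | u y \<noteq> 0 \<and> y \<in> U. ennreal (u y))"
      using x U assms(1) by (intro member_le_sum) auto
    finally show ?thesis
      using U by (subst emeasure_atomic_measure[OF assms(1)]) auto
  qed
  then show "x \<in> measure_support (atomic_measure u)"
    by (simp add: measure_support_def)
qed

lemma atomic_measure_in_VRm_set:
  assumes "u \<in> topspace (VR r)"
  shows "atomic_measure u \<in> VRm_set r"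
proof -
  note u = VR_topspaceD[OF assms]
  have "(\<Sum>x | u x \<noteq> 0. ennreal (u x)) = 1"
    using u(1,4) by (simp add: sum_ennreal)
  moreover have "{x. u x \<noteq> 0} \<in> sets borel"
    using finite_imp_closed[OF u(2)] by simp
  ultimately have "emeasure (atomic_measure u) {x. u x \<noteq> 0} = 1"
    and "emeasure (atomic_measure u) (space (atomic_measure u)) = 1"
    using u(2) by (simp_all add: emeasure_atomic_measure)
  then show ?thesis
    using u(2,5) by (auto simp: VRm_set_def measure_support_atomic_measure[OF u(2,1)] intro: prob_spaceI)
qed

lemma topspace_VRm [simp]: "topspace (VRm r) = VRm_set r"
  by (simp add: VRm_def topspace_pullback_topology)

lemma continuous_map_VRm_integral:
  assumes "continuous_on UNIV f" and "bounded (range f)"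
  shows "continuous_map (VRm r) euclideanreal (\<lambda>\<mu>. integral\<^sup>L \<mu> f)"
proof -
  have "apply_bcontfun (Bcontfun f) = f"
    using assms by (simp add: Bcontfun_inverse bcontfun_def)
  moreover have "continuous_map euclidean euclideanreal (\<lambda>h. h (Bcontfun f))"
    by (simp add: continuous_on_product_coordinates)
  then have "continuous_map (VRm r) euclideanreal
      ((\<lambda>h. h (Bcontfun f)) \<circ> (\<lambda>\<mu> f. integral\<^sup>L \<mu> (apply_bcontfun f)))"
    unfolding VRm_def by (rule continuous_map_pullback)
  ultimately show ?thesis
    by (simp add: o_def)
qed

text \<open>
  On a closed simplex, integrating a fixed function against the atomic measure gives a finite linear
  combination of the coordinates, so the map is continuous into the weak topology.
\<close>

lemma (in G_metric_space) G_map_VR_VRm: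
  "G_map G (VR r) (VR_action \<alpha>) (VRm r) (VRm_action \<alpha>) atomic_measure"
proof -
  have "continuous_map (VR r) (VRm r) (atomic_measure :: ('a \<Rightarrow> real) \<Rightarrow> 'a measure)"
    unfolding VR_def
  proof (rule continuous_map_from_realization)
    fix \<sigma> :: "'a set" assume \<sigma>: "\<sigma> \<in> VR_complex r"
    then have sub: "closed_simplex \<sigma> \<subseteq> topspace (VR r)"
      by (auto simp: VR_def topspace_geometric_realization)
    have "continuous_map (top_of_set (closed_simplex \<sigma>)) euclideanreal
        (\<lambda>u. integral\<^sup>L (atomic_measure u) (apply_bcontfun f))" for f :: "'a \<Rightarrow>\<^sub>C real"
    proof (rule continuous_map_eq)
      show "continuous_map (top_of_set (closed_simplex \<sigma>)) euclideanreal
          (\<lambda>u. \<Sum>x\<in>\<sigma>. u x * apply_bcontfun f x)"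
        by (simp, intro continuous_on_sum continuous_on_mult_right
            continuous_on_subset[OF continuous_on_product_coordinates]) simp
      fix u assume u: "u \<in> topspace (top_of_set (closed_simplex \<sigma>))"
      then have "u \<in> topspace (VR r)" using sub by auto
      note D = VR_topspaceD[OF this]
      have "(\<Sum>x\<in>\<sigma>. u x * apply_bcontfun f x) = (\<Sum>x | u x \<noteq> 0. u x * apply_bcontfun f x)"
        by (rule sum.mono_neutral_right)
          (use u \<sigma> in \<open>auto simp: VR_complex_def closed_simplex_def\<close>)
      then show "(\<Sum>x\<in>\<sigma>. u x * apply_bcontfun f x) =
          integral\<^sup>L (atomic_measure u) (apply_bcontfun f)"
        by (simp add: integral_atomic_measure[OF D(2,1)] borel_measurable_continuous_onI)
    qed
    then have "continuous_map (top_of_set (closed_simplex \<sigma>)) euclidean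
        ((\<lambda>\<mu> (f :: 'a \<Rightarrow>\<^sub>C real). integral\<^sup>L \<mu> (apply_bcontfun f)) \<circ> atomic_measure)"
      by (simp only: o_def continuous_map_componentwise_UNIV euclidean_product_topology[symmetric]) simp
    moreover have "topspace (top_of_set (closed_simplex \<sigma>)) \<subseteq> atomic_measure -` VRm_set r"
      using sub by (auto intro!: atomic_measure_in_VRm_set)
    ultimately show "continuous_map (top_of_set (closed_simplex \<sigma>)) (VRm r) atomic_measure"
      unfolding VRm_def by (rule continuous_map_pullback')
  qed
  moreover have "atomic_measure (VR_action \<alpha> g u) = VRm_action \<alpha> g (atomic_measure u)"
    if g: "g \<in> carrier G" and u: "u \<in> topspace (VR r)" for g u
  proof -
    note D = VR_topspaceD[OF u]
    have m: "\<alpha> g \<in> borel_measurable (atomic_measure u)"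
      using continuous_act[OF g]
      by (simp add: measurable_cong_sets[OF sets_atomic_measure refl] borel_measurable_continuous_onI)
    have "{x. VR_action \<alpha> g u x \<noteq> 0} = \<alpha> (inv g) -` {x. u x \<noteq> 0}"
      using g by (simp add: VR_action_apply vimage_def)
    then have fin: "finite {x. VR_action \<alpha> g u x \<noteq> 0}"
      using finite_vimageI[OF D(2) inj_act[OF inv_carrier[OF g]]] by simp
    show ?thesis
    proof (rule measure_eqI)
      fix A assume "A \<in> sets (atomic_measure (VR_action \<alpha> g u))"
      then have A: "A \<in> sets borel" by simp
      have "\<alpha> g -` A \<in> sets borel"
        using measurable_sets[OF m A] by simp
      moreover have "(\<Sum>x | VR_action \<alpha> g u x \<noteq> 0 \<and> x \<in> A. ennreal (VR_action \<alpha> g u x)) =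
          (\<Sum>x | u x \<noteq> 0 \<and> x \<in> \<alpha> g -` A. ennreal (u x))"
        by (rule sum.reindex_bij_witness[where i = "\<alpha> g" and j = "\<alpha> (inv g)"])
          (use g in \<open>auto simp: VR_action_apply\<close>)
      ultimately show "emeasure (atomic_measure (VR_action \<alpha> g u)) A =
          emeasure (VRm_action \<alpha> g (atomic_measure u)) A"
        using m A fin D(2) by (simp add: VRm_action_def emeasure_distr emeasure_atomic_measure)
    qed (simp add: VRm_action_def)
  qed
  ultimately show ?thesis
    by (simp add: G_map_def)
qed

text \<open>
  The weight of a net point is the integral of a tent function of radius \<open>\<delta>/2\<close> around it. It is
  continuous by definition of the weak topology, and it vanishes unless a point of the support is
  closer than \<open>\<delta>/2\<close>; so the diameter grows by at most \<open>\<delta>\<close>.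
\<close>

lemma (in G_metric_space) ex_G_map_VRm_VR:
  assumes "finite (carrier G)" and "compact (UNIV :: 'a set)" and "0 < \<delta>"
  shows "\<exists>f. G_map G (VRm r) (VRm_action \<alpha>) (VR (r + \<delta>)) (VR_action \<alpha>) f"
proof -
  obtain N where N: "finite N" "\<And>g x. g \<in> carrier G \<Longrightarrow> x \<in> N \<Longrightarrow> \<alpha> g x \<in> N"
    and dense: "\<And>y. \<exists>x\<in>N. dist x y < \<delta> / 2"
    using ex_invariant_net[OF assms(1,2) half_gt_zero[OF assms(3)]] by metis
  define tent where "tent x y = max 0 (\<delta> / 2 - dist x y)" for x y :: 'a
  have cont: "continuous_on UNIV (tent x)" for x
    unfolding tent_def by (intro continuous_intros)
  have nonneg: "0 \<le> tent x y" and le: "tent x y \<le> \<delta> / 2" for x y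
    using assms(3) by (simp_all add: tent_def max_def)
  have bdd: "bounded (range (tent x))" for x
    unfolding bounded_iff using nonneg le by (intro exI[of _ "\<delta> / 2"]) simp
  define F where "F \<mu> x = (if x \<in> N then integral\<^sup>L \<mu> (tent x) else 0)" for \<mu> x
  have "G_map G (VRm r) (VRm_action \<alpha>) (VR (r + \<delta>)) (VR_action \<alpha>) (\<lambda>\<mu>. normalized (F \<mu>))"
  proof (rule G_map_to_VR)
    fix \<mu> :: "'a measure" assume "\<mu> \<in> topspace (VRm r)"
    then have \<mu>: "prob_space \<mu>" "sets \<mu> = sets borel" "finite (measure_support \<mu>)"
      "emeasure \<mu> (measure_support \<mu>) = 1" "diameter (measure_support \<mu>) < r"
      by (auto simp: VRm_set_def)
    interpret prob_space \<mu> by (rule \<mu>(1))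
    have meas: "tent x \<in> borel_measurable \<mu>" for x
      using borel_measurable_continuous_onI[OF cont] by (simp add: measurable_cong_sets[OF \<mu>(2) refl])
    have int: "integrable \<mu> (tent x)" for x
      by (rule integrable_const_bound[where B = "\<delta> / 2"]) (use nonneg le meas in auto)
    have AE_supp: "AE y in \<mu>. y \<in> measure_support \<mu>"
    proof (rule AE_prob_1)
      show "prob (measure_support \<mu>) = 1"
        using \<mu>(4) by (simp add: measure_def)
    qed
    show "0 \<le> F \<mu> x" for x
      using nonneg by (simp add: F_def)
    show "\<exists>x. F \<mu> x \<noteq> 0"
    proof (rule ccontr)
      assume "\<nexists>x. F \<mu> x \<noteq> 0"
      then have F0: "F \<mu> x = 0" for x
        by blast
      have "integral\<^sup>L \<mu> (tent x) = 0" if "x \<in> N" for x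
        using F0[of x] that by (simp add: F_def)
      then have "AE y in \<mu>. tent x y = 0" if "x \<in> N" for x
        using integral_nonneg_eq_0_iff_AE[OF int, of x] nonneg that by simp
      then have "AE y in \<mu>. \<forall>x\<in>N. tent x y = 0"
        by (simp only: AE_finite_all[OF N(1)]) blast
      \<comment> \<open>The tents around the points of the net cover the space, so they cannot all have integral 0.\<close>
      moreover have "(\<forall>x\<in>N. tent x y = 0) = False" for y
      proof -
        obtain x where "x \<in> N" "dist x y < \<delta> / 2"
          using dense by blast
        then have "tent x y \<noteq> 0"
          by (simp add: tent_def)
        with \<open>x \<in> N\<close> show ?thesis
          by blast
      qed
      ultimately show False
        by simp
    qed
    have near: "\<exists>y\<in>measure_support \<mu>. dist x y < \<delta> / 2" if "F \<mu> x \<noteq> 0" for x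
    proof (rule ccontr)
      assume far: "\<not> ?thesis"
      have "tent x y = 0" if "y \<in> measure_support \<mu>" for y
      proof -
        have "\<not> dist x y < \<delta> / 2"
          using far that by blast
        then show ?thesis
          by (simp add: tent_def max_def)
      qed
      then have "AE y in \<mu>. tent x y = 0"
        by (rule eventually_mono[OF AE_supp])
      then have "integral\<^sup>L \<mu> (tent x) = 0"
        by (rule integral_eq_zero_AE)
      with that show False
        by (simp add: F_def split: if_splits)
    qed
    show "dist x x' < r + \<delta>" if "F \<mu> x \<noteq> 0" "F \<mu> x' \<noteq> 0" for x x'
    proof -
      obtain y y' where y: "y \<in> measure_support \<mu>" "dist x y < \<delta> / 2"
        and y': "y' \<in> measure_support \<mu>" "dist x' y' < \<delta> / 2"
        using near[OF \<open>F \<mu> x \<noteq> 0\<close>] near[OF \<open>F \<mu> x' \<noteq> 0\<close>] by blast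
      have "dist y y' \<le> diameter (measure_support \<mu>)"
        using y(1) y'(1) finite_imp_bounded[OF \<mu>(3)] by (intro diameter_bounded_bound)
      moreover have "dist x x' \<le> dist x y + dist y y' + dist x' y'"
        using dist_triangle[of x x' y] dist_triangle[of y x' y'] by (simp add: dist_commute)
      ultimately show ?thesis
        using y(2) y'(2) \<mu>(5) by linarith
    qed
    show "\<exists>V M. openin (VRm r) V \<and> \<mu> \<in> V \<and> finite M \<and> (\<forall>t\<in>V. {v. F t v \<noteq> 0} \<subseteq> M)"
      using N(1) \<open>\<mu> \<in> topspace (VRm r)\<close>
      by (intro exI[of _ "topspace (VRm r)"] exI[of _ N] conjI openin_topspace) (auto simp: F_def)
    show "F (VRm_action \<alpha> g \<mu>) x = F \<mu> (\<alpha> (inv g) x)" if g: "g \<in> carrier G" for g x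
    proof -
      have "\<alpha> g \<in> measurable \<mu> borel"
        using continuous_act[OF g]
        by (simp add: measurable_cong_sets[OF \<mu>(2) refl] borel_measurable_continuous_onI)
      then have "integral\<^sup>L (VRm_action \<alpha> g \<mu>) (tent x) = integral\<^sup>L \<mu> (\<lambda>y. tent x (\<alpha> g y))"
        unfolding VRm_action_def
        by (rule integral_distr) (simp add: borel_measurable_continuous_onI cont)
      moreover have "tent x (\<alpha> g y) = tent (\<alpha> (inv g) x) y" for y
        using g by (simp add: tent_def dist_act_inv)
      moreover have "x \<in> N \<longleftrightarrow> \<alpha> (inv g) x \<in> N"
        using N(2)[of "inv g" x] N(2)[of g "\<alpha> (inv g) x"] g by auto
      ultimately show ?thesis
        by (simp add: F_def)
    qed
  next
    show "continuous_map (VRm r) euclideanreal (\<lambda>\<mu>. F \<mu> x)" for x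
      unfolding F_def using continuous_map_VRm_integral[OF cont bdd] by (cases "x \<in> N") simp_all
  qed
  then show ?thesis
    by blast
qed

section \<open>The retraction onto the tight span\<close>

lemma mspace_Linf: "f \<in> mspace Linf \<longleftrightarrow> bounded (range f)"
  by (simp add: Linf_def Metric_space.fspace_def[OF Met_TC.Metric_space_axioms])

lemma abs_diff_le_mdist_Linf:
  assumes "f \<in> mspace Linf" and "g \<in> mspace Linf"
  shows "\<bar>f x - g x\<bar> \<le> mdist Linf f g"
proof -
  have "bdd_above (range (\<lambda>x. dist (f x) (g x)))"
    using Met_TC.bdd_above_dist[of f UNIV g] assms by (simp add: Linf_def)
  then have "dist (f x) (g x) \<le> (SUP x. dist (f x) (g x))"
    by (rule cSUP_upper[OF UNIV_I])
  then show ?thesis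
    using assms by (simp add: Linf_def Met_TC.fdist_def dist_real_def)
qed

lemma mdist_Linf_le:
  assumes "f \<in> mspace Linf" and "g \<in> mspace Linf" and "\<And>x. \<bar>f x - g x\<bar> \<le> e"
  shows "mdist Linf f g \<le> e"
proof -
  have "(SUP x. dist (f x) (g x)) \<le> e"
    by (rule cSUP_least) (use assms(3) in \<open>auto simp: dist_real_def\<close>)
  then show ?thesis
    using assms(1,2) by (simp add: Linf_def Met_TC.fdist_def)
qed

text \<open>
  For \<open>f\<close> in \<open>\<Delta>_set\<close> this is the smallest function \<open>h\<close> with \<open>dist x z \<le> h x + f z\<close> for all \<open>x\<close> and \<open>z\<close>. It lies
  below \<open>f\<close>, and \<open>f\<close> is in the tight span iff it equals its conjugate.
\<close>

definition dist_conjugate :: "('a :: metric_space \<Rightarrow> real) \<Rightarrow> 'a \<Rightarrow> real"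
  where "dist_conjugate f = (\<lambda>x. SUP z. dist x z - f z)"

text \<open>
  The conjugate of \<open>f\<close> need not lie in \<open>\<Delta>_set\<close>, but the midpoint of \<open>f\<close> and its conjugate does.
\<close>

definition halve_gap :: "('a :: metric_space \<Rightarrow> real) \<Rightarrow> 'a \<Rightarrow> real"
  where "halve_gap f = (\<lambda>x. (f x + dist_conjugate f x) / 2)"

text \<open>
  The retraction is the limit of the midpoint construction. Unlike a retraction obtained from Zorn's
  lemma, it is given by a formula in terms of distances, so it commutes with isometries.
\<close>

definition tight_retract :: "('a :: metric_space \<Rightarrow> real) \<Rightarrow> 'a \<Rightarrow> real"
  where "tight_retract f = (\<lambda>x. lim (\<lambda>n. (halve_gap ^^ n) f x))"

lemma \<Delta>_setI:
  assumes "\<And>x x'. dist x x' \<le> f x + f x'" and "\<And>x. f x \<le> B"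
  shows "f \<in> \<Delta>_set"
proof -
  have "0 \<le> f x" for x
    using assms(1)[of x x] by simp
  then have "bounded (range f)"
    unfolding bounded_iff using assms(2) by (intro exI[of _ B]) auto
  then show ?thesis
    using assms(1) by (simp add: \<Delta>_set_def mspace_Linf)
qed

lemma \<Delta>_setD:
  assumes "f \<in> \<Delta>_set"
  shows "dist x x' \<le> f x + f x'" and "0 \<le> f x" and "f \<in> mspace Linf" and "\<exists>B. \<forall>x. f x \<le> B"
proof -
  show d: "dist x x' \<le> f x + f x'" for x x'
    using assms by (simp add: \<Delta>_set_def)
  show "0 \<le> f x"
    using d[of x x] by simp
  show "f \<in> mspace Linf"
    using assms by (simp add: \<Delta>_set_def)
  then show "\<exists>B. \<forall>x. f x \<le> B"
    unfolding mspace_Linf bounded_iff by (auto simp: abs_le_iff)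
qed

lemma bounded_dist:
  assumes "bounded (UNIV :: 'a set)"
  obtains C where "0 < C" and "\<And>x y :: 'a :: metric_space. dist x y \<le> C"
proof
  show "0 < diameter (UNIV :: 'a set) + 1"
    using diameter_ge_0[OF assms] by simp
  show "dist x y \<le> diameter (UNIV :: 'a set) + 1" for x y :: 'a
    using diameter_bounded_bound[OF assms, of x y] by simp
qed

lemma dist_conjugate_least:
  assumes "\<And>z. dist x z - f z \<le> c"
  shows "dist_conjugate f x \<le> c"
  unfolding dist_conjugate_def by (rule cSUP_least) (use assms in auto)

context
  assumes bounded_space: "bounded (UNIV :: 'a :: metric_space set)"
begin

lemma dist_conjugate_upper:
  fixes f :: "'a \<Rightarrow> real"
  assumes "f \<in> \<Delta>_set"
  shows "dist x z - f z \<le> dist_conjugate f x"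
proof -
  obtain C where C: "\<And>x y :: 'a. dist x y \<le> C"
    using bounded_dist[OF bounded_space] by metis
  have "dist x z - f z \<le> C" for z
    using C[of x z] \<Delta>_setD(2)[OF assms, of z] by simp
  then have "bdd_above (range (\<lambda>z. dist x z - f z))"
    by (intro bdd_aboveI[of _ C]) auto
  then show ?thesis
    unfolding dist_conjugate_def by (rule cSUP_upper[OF UNIV_I])
qed

lemma dist_conjugate_le:
  fixes f :: "'a \<Rightarrow> real"
  assumes "f \<in> \<Delta>_set"
  shows "dist_conjugate f x \<le> f x"
  by (rule dist_conjugate_least) (use \<Delta>_setD(1)[OF assms, of x] in \<open>simp add: algebra_simps\<close>)

lemma dist_conjugate_antimono:
  fixes f g :: "'a \<Rightarrow> real"
  assumes "g \<in> \<Delta>_set" and "\<And>z. g z \<le> f z + e"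
  shows "dist_conjugate f x \<le> dist_conjugate g x + e"
proof (rule dist_conjugate_least)
  fix z
  show "dist x z - f z \<le> dist_conjugate g x + e"
    using dist_conjugate_upper[OF assms(1), of x z] assms(2)[of z] by linarith
qed

lemma halve_gap_le:
  fixes f :: "'a \<Rightarrow> real"
  assumes "f \<in> \<Delta>_set"
  shows "halve_gap f x \<le> f x"
  using dist_conjugate_le[OF assms, of x] by (simp add: halve_gap_def)

lemma halve_gap_in_\<Delta>_set:
  fixes f :: "'a \<Rightarrow> real"
  assumes "f \<in> \<Delta>_set"
  shows "halve_gap f \<in> \<Delta>_set"
proof -
  obtain B where B: "\<And>x. f x \<le> B"
    using \<Delta>_setD(4)[OF assms] by blast
  show ?thesis
  proof (rule \<Delta>_setI)
    fix x x'
    show "dist x x' \<le> halve_gap f x + halve_gap f x'"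
      using dist_conjugate_upper[OF assms, of x x'] dist_conjugate_upper[OF assms, of x' x]
      by (simp add: halve_gap_def dist_commute field_simps)
    show "halve_gap f x \<le> B"
      using halve_gap_le[OF assms, of x] B[of x] by simp
  qed
qed

text \<open>
  If \<open>f\<close> and \<open>g\<close> differ by at most \<open>e\<close>, then so do their conjugates, and therefore the midpoints.
\<close>

lemma halve_gap_nonexpansive:
  fixes f g :: "'a \<Rightarrow> real"
  assumes "f \<in> \<Delta>_set" and "g \<in> \<Delta>_set" and "\<And>x. \<bar>f x - g x\<bar> \<le> e"
  shows "\<bar>halve_gap f x - halve_gap g x\<bar> \<le> e"
proof -
  have 1: "g z \<le> f z + e" and 2: "f z \<le> g z + e" for z
    using assms(3)[of z] by (simp_all add: abs_le_iff)
  show ?thesis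
    using dist_conjugate_antimono[OF assms(2) 1, of x] dist_conjugate_antimono[OF assms(1) 2, of x]
      assms(3)[of x]
    unfolding halve_gap_def abs_le_iff by (simp add: field_simps)
qed

text \<open>
  Passing from \<open>f\<close> to the smaller function \<open>halve_gap f\<close> makes the conjugate larger. Hence the
  distance of a function to its conjugate is at least halved, and the iteration converges to a function
  that equals its conjugate.
\<close>

lemma halve_gap_halves:
  fixes f :: "'a \<Rightarrow> real"
  assumes "f \<in> \<Delta>_set"
  shows "halve_gap f x - dist_conjugate (halve_gap f) x \<le> (f x - dist_conjugate f x) / 2"
proof -
  have "dist_conjugate f x \<le> dist_conjugate (halve_gap f) x"
    using dist_conjugate_antimono[OF halve_gap_in_\<Delta>_set[OF assms], where e = 0]
      halve_gap_le[OF assms] by simp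
  then show ?thesis
    by (simp add: halve_gap_def field_simps)
qed

lemma halve_gap_iter_in_\<Delta>_set:
  fixes f :: "'a \<Rightarrow> real"
  assumes "f \<in> \<Delta>_set"
  shows "(halve_gap ^^ n) f \<in> \<Delta>_set"
  by (induction n) (simp_all add: assms halve_gap_in_\<Delta>_set)

lemma halve_gap_iter_gap:
  fixes f :: "'a \<Rightarrow> real"
  assumes "f \<in> \<Delta>_set"
  shows "(halve_gap ^^ n) f x - dist_conjugate ((halve_gap ^^ n) f) x
    \<le> (f x - dist_conjugate f x) / 2 ^ n"
proof (induction n)
  case (Suc n)
  have "(halve_gap ^^ Suc n) f x - dist_conjugate ((halve_gap ^^ Suc n) f) x
      \<le> ((halve_gap ^^ n) f x - dist_conjugate ((halve_gap ^^ n) f) x) / 2"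
    using halve_gap_halves[OF halve_gap_iter_in_\<Delta>_set[OF assms], of n x] by simp
  also have "\<dots> \<le> (f x - dist_conjugate f x) / 2 ^ n / 2"
    using Suc.IH by (rule divide_right_mono) simp
  finally show ?case
    by (simp add: mult.commute)
qed simp

lemma decseq_halve_gap_iter:
  fixes f :: "'a \<Rightarrow> real"
  assumes "f \<in> \<Delta>_set"
  shows "decseq (\<lambda>n. (halve_gap ^^ n) f x)"
  by (rule decseq_SucI) (simp add: halve_gap_le halve_gap_iter_in_\<Delta>_set assms)

lemma halve_gap_iter_tendsto:
  fixes f :: "'a \<Rightarrow> real"
  assumes "f \<in> \<Delta>_set"
  shows "(\<lambda>n. (halve_gap ^^ n) f x) \<longlonglongrightarrow> tight_retract f x"
proof -
  obtain l where "(\<lambda>n. (halve_gap ^^ n) f x) \<longlonglongrightarrow> l"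
    using decseq_convergent[OF decseq_halve_gap_iter[OF assms]]
      \<Delta>_setD(2)[OF halve_gap_iter_in_\<Delta>_set[OF assms]] by metis
  then show ?thesis
    by (simp add: tight_retract_def limI)
qed

lemma tight_retract_le_iter:
  fixes f :: "'a \<Rightarrow> real"
  assumes "f \<in> \<Delta>_set"
  shows "tight_retract f x \<le> (halve_gap ^^ n) f x"
  using decseq_halve_gap_iter[OF assms] halve_gap_iter_tendsto[OF assms] by (rule decseq_ge)

lemma tight_retract_le:
  fixes f :: "'a \<Rightarrow> real"
  assumes "f \<in> \<Delta>_set"
  shows "tight_retract f x \<le> f x"
  using tight_retract_le_iter[OF assms, of x 0] by simp

lemma tight_retract_in_\<Delta>_set:
  fixes f :: "'a \<Rightarrow> real"
  assumes "f \<in> \<Delta>_set"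
  shows "tight_retract f \<in> \<Delta>_set"
proof -
  obtain B where B: "\<And>x. f x \<le> B"
    using \<Delta>_setD(4)[OF assms] by blast
  show ?thesis
  proof (rule \<Delta>_setI)
    fix x x'
    have "(\<lambda>n. (halve_gap ^^ n) f x + (halve_gap ^^ n) f x')
        \<longlonglongrightarrow> tight_retract f x + tight_retract f x'"
      by (intro tendsto_add halve_gap_iter_tendsto assms)
    then show "dist x x' \<le> tight_retract f x + tight_retract f x'"
      by (rule LIMSEQ_le_const) (use \<Delta>_setD(1)[OF halve_gap_iter_in_\<Delta>_set[OF assms]] in blast)
    show "tight_retract f x \<le> B"
      using tight_retract_le[OF assms, of x] B[of x] by simp
  qed
qed

text \<open>
  Conjugation reverses order, so any \<open>g \<le> f\<close> in \<open>\<Delta>_set\<close> satisfies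
  \<open>f \<le> dist_conjugate f \<le> dist_conjugate g \<le> g\<close>.
\<close>

lemma tight_spanI:
  fixes f :: "'a \<Rightarrow> real"
  assumes "f \<in> \<Delta>_set" and "\<And>x. f x \<le> dist_conjugate f x"
  shows "f \<in> tight_span"
proof -
  have "g = f" if g: "g \<in> \<Delta>_set" "g \<le> f" for g
  proof
    fix x
    have "f x \<le> dist_conjugate g x"
      using dist_conjugate_antimono[OF g(1), of f 0 x] g(2) assms(2)[of x] by (simp add: le_fun_def)
    also have "\<dots> \<le> g x"
      by (rule dist_conjugate_le[OF g(1)])
    finally show "g x = f x"
      using g(2) by (simp add: le_fun_def order.antisym)
  qed
  then show ?thesis
    using assms(1) by (simp add: tight_span_def)
qed

lemma tight_retract_in_tight_span:
  fixes f :: "'a \<Rightarrow> real"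
  assumes "f \<in> \<Delta>_set"
  shows "tight_retract f \<in> tight_span"
proof (rule tight_spanI[OF tight_retract_in_\<Delta>_set[OF assms]])
  fix x
  have "(\<lambda>n. dist_conjugate (tight_retract f) x + (f x - dist_conjugate f x) / 2 ^ n)
      \<longlonglongrightarrow> dist_conjugate (tight_retract f) x + 0"
    by (intro tendsto_add tendsto_const LIMSEQ_divide_realpow_zero) simp
  moreover have "tight_retract f x
      \<le> dist_conjugate (tight_retract f) x + (f x - dist_conjugate f x) / 2 ^ n" for n
  proof -
    have "dist_conjugate ((halve_gap ^^ n) f) x \<le> dist_conjugate (tight_retract f) x"
      using dist_conjugate_antimono[OF tight_retract_in_\<Delta>_set[OF assms], where e = 0]
        tight_retract_le_iter[OF assms] by simp
    then show ?thesis
      using tight_retract_le_iter[OF assms, of x n] halve_gap_iter_gap[OF assms, of n x] by linarith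
  qed
  ultimately show "tight_retract f x \<le> dist_conjugate (tight_retract f) x"
    using LIMSEQ_le_const by fastforce
qed

lemma tight_retract_nonexpansive:
  fixes f g :: "'a \<Rightarrow> real"
  assumes "f \<in> \<Delta>_set" and "g \<in> \<Delta>_set" and "\<And>x. \<bar>f x - g x\<bar> \<le> e"
  shows "\<bar>tight_retract f x - tight_retract g x\<bar> \<le> e"
proof -
  have iter: "\<bar>(halve_gap ^^ n) f x - (halve_gap ^^ n) g x\<bar> \<le> e" for n x
    by (induction n arbitrary: x) (simp_all add: assms halve_gap_nonexpansive halve_gap_iter_in_\<Delta>_set)
  have "(\<lambda>n. \<bar>(halve_gap ^^ n) f x - (halve_gap ^^ n) g x\<bar>)
      \<longlonglongrightarrow> \<bar>tight_retract f x - tight_retract g x\<bar>"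
    by (intro tendsto_rabs tendsto_diff halve_gap_iter_tendsto assms(1,2))
  then show ?thesis
    by (rule LIMSEQ_le_const2) (use iter in blast)
qed

text \<open>
  The midpoint \<open>halve_gap f\<close> is a smaller element of \<open>\<Delta>_set\<close>, so minimality forces it to be \<open>f\<close>.
\<close>

lemma tight_span_eq_conjugate:
  fixes f :: "'a \<Rightarrow> real"
  assumes "f \<in> tight_span"
  shows "dist_conjugate f = f"
proof -
  have f: "f \<in> \<Delta>_set"
    using assms by (simp add: tight_span_def)
  then have "halve_gap f = f"
    using assms halve_gap_in_\<Delta>_set[OF f] halve_gap_le[OF f] by (simp add: tight_span_def le_fun_def)
  then have "(f x + dist_conjugate f x) / 2 = f x" for x
    unfolding halve_gap_def by (rule fun_cong)
  then show ?thesis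
    by (auto simp: field_simps)
qed

lemma tight_span_lipschitz:
  fixes f :: "'a \<Rightarrow> real"
  assumes "f \<in> tight_span"
  shows "f x \<le> f y + dist x y"
proof -
  have f: "f \<in> \<Delta>_set"
    using assms by (simp add: tight_span_def)
  have "dist_conjugate f x \<le> f y + dist x y"
  proof (rule dist_conjugate_least)
    fix z
    show "dist x z - f z \<le> f y + dist x y"
      using dist_triangle[of x z y] \<Delta>_setD(1)[OF f, of y z] by simp
  qed
  then show ?thesis
    by (simp add: tight_span_eq_conjugate[OF assms])
qed

text \<open>
  The Lipschitz bound and the defining inequality of \<open>\<Delta>_set\<close> bound the difference by \<open>f x\<close>
  everywhere, and at the point \<open>x\<close> itself it equals \<open>f x\<close>. Thus the neighbourhoods of the space in its
  tight span are sublevel sets of the infimum.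
\<close>

lemma mdist_tight_span_dist:
  fixes f :: "'a \<Rightarrow> real"
  assumes "f \<in> tight_span"
  shows "mdist Linf f (dist x) = f x"
proof -
  have f: "f \<in> \<Delta>_set"
    using assms by (simp add: tight_span_def)
  obtain C where C: "\<And>x y :: 'a. dist x y \<le> C"
    using bounded_dist[OF bounded_space] by metis
  have d: "dist x \<in> mspace Linf"
    unfolding mspace_Linf bounded_iff using C by (intro exI[of _ C]) auto
  have "\<bar>f z - dist x z\<bar> \<le> f x" for z
    using tight_span_lipschitz[OF assms, of z x] \<Delta>_setD(1)[OF f, of x z]
    by (simp add: abs_le_iff dist_commute)
  then have "mdist Linf f (dist x) \<le> f x"
    by (rule mdist_Linf_le[OF \<Delta>_setD(3)[OF f] d])
  moreover have "f x \<le> mdist Linf f (dist x)"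
    using abs_diff_le_mdist_Linf[OF \<Delta>_setD(3)[OF f] d, of x] by simp
  ultimately show ?thesis
    by simp
qed

lemma tight_span_nbhd_eq:
  "tight_span_nbhd r =
    subtopology (mtopology_of Linf) {f :: 'a \<Rightarrow> real. f \<in> tight_span \<and> (\<exists>x. f x < r)}"
proof -
  have "{f :: 'a \<Rightarrow> real. f \<in> tight_span \<and> (\<exists>x. mdist Linf f (dist x) < r)} =
      {f. f \<in> tight_span \<and> (\<exists>x. f x < r)}"
    using mdist_tight_span_dist by (metis (no_types, lifting))
  then show ?thesis
    by (simp add: tight_span_nbhd_def)
qed

lemma topspace_tight_span_nbhd:
  "topspace (tight_span_nbhd r) = {f :: 'a \<Rightarrow> real. f \<in> tight_span \<and> (\<exists>x. f x < r)}"
  unfolding tight_span_nbhd_eq by (auto simp: tight_span_def \<Delta>_set_def)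

end

lemma dist_conjugate_isometry:
  assumes "surj \<phi>" and "\<And>x y. dist (\<phi> x) (\<phi> y) = dist x y"
  shows "dist_conjugate (\<lambda>x. f (\<phi> x)) x = dist_conjugate f (\<phi> x)"
proof -
  have "(SUP z. dist x z - f (\<phi> z)) = (SUP z. dist (\<phi> x) (\<phi> z) - f (\<phi> z))"
    by (simp add: assms(2))
  also have "\<dots> = (SUP z\<in>range \<phi>. dist (\<phi> x) z - f z)"
    by (simp add: image_image)
  finally show ?thesis
    by (simp add: dist_conjugate_def assms(1))
qed

lemma tight_retract_isometry:
  assumes "surj \<phi>" and "\<And>x y. dist (\<phi> x) (\<phi> y) = dist x y"
  shows "tight_retract (\<lambda>x. f (\<phi> x)) x = tight_retract f (\<phi> x)"
proof -
  have "(halve_gap ^^ n) (\<lambda>x. f (\<phi> x)) = (\<lambda>x. (halve_gap ^^ n) f (\<phi> x))" for n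
  proof (induction n)
    case (Suc n)
    have "halve_gap (\<lambda>x. h (\<phi> x)) = (\<lambda>x. halve_gap h (\<phi> x))" for h
      unfolding halve_gap_def by (simp add: dist_conjugate_isometry[OF assms])
    then show ?case
      by (simp add: Suc.IH)
  qed simp
  then show ?thesis
    by (simp add: tight_retract_def)
qed

section \<open>From the Vietoris--Rips complex to the tight span\<close>

text \<open>
  The supremum over pairs is twice the smallest constant whose addition to a bounded function \<open>w\<close> gives
  \<open>w x + w x' \<ge> dist x x'\<close>.
\<close>

definition raise_to_\<Delta> :: "('a :: metric_space \<Rightarrow> real) \<Rightarrow> 'a \<Rightarrow> real"
  where "raise_to_\<Delta> w = (\<lambda>x. w x + (SUP (y, z). dist y z - w y - w z) / 2)"

lemma raise_to_\<Delta>_le: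
  assumes "\<And>y z. dist y z - w y - w z \<le> c"
  shows "raise_to_\<Delta> w x \<le> w x + c / 2"
proof -
  have "(SUP (y, z). dist y z - w y - w z) \<le> c"
    by (rule cSUP_least) (use assms in auto)
  then show ?thesis
    by (simp add: raise_to_\<Delta>_def)
qed

context
  assumes bounded_space: "bounded (UNIV :: 'a :: metric_space set)"
begin

lemma bdd_above_defect:
  fixes w :: "'a \<Rightarrow> real"
  assumes "\<And>x. \<bar>w x\<bar> \<le> B"
  shows "bdd_above (range (\<lambda>(y, z). dist y z - w y - w z))"
proof -
  obtain C where C: "\<And>x y :: 'a. dist x y \<le> C"
    using bounded_dist[OF bounded_space] by metis
  have "dist y z - w y - w z \<le> C + 2 * B" for y z
    using C[of y z] assms[of y] assms[of z] by (simp add: abs_le_iff)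
  then show ?thesis
    by (intro bdd_aboveI[of _ "C + 2 * B"]) auto
qed

lemma defect_upper:
  fixes w :: "'a \<Rightarrow> real"
  assumes "\<And>x. \<bar>w x\<bar> \<le> B"
  shows "dist y z - w y - w z \<le> (SUP (y, z). dist y z - w y - w z)"
  using cSUP_upper[OF UNIV_I bdd_above_defect[of w B], where x = "(y, z)"] assms by simp

lemma raise_to_\<Delta>_in_\<Delta>_set:
  fixes w :: "'a \<Rightarrow> real"
  assumes B: "\<And>x. \<bar>w x\<bar> \<le> B"
  shows "raise_to_\<Delta> w \<in> \<Delta>_set"
proof (rule \<Delta>_setI)
  fix x x'
  show "dist x x' \<le> raise_to_\<Delta> w x + raise_to_\<Delta> w x'"
    using defect_upper[of w B x x'] B by (simp add: raise_to_\<Delta>_def)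
  show "raise_to_\<Delta> w x \<le> B + (SUP (y, z). dist y z - w y - w z) / 2"
    using B[of x] by (simp add: raise_to_\<Delta>_def)
qed

text \<open>
  One \<open>e\<close> comes from \<open>w\<close> itself and another one from the constant by which it is raised.
\<close>

lemma raise_to_\<Delta>_lipschitz:
  fixes w w' :: "'a \<Rightarrow> real"
  assumes B: "\<And>x. \<bar>w x\<bar> \<le> B" and B': "\<And>x. \<bar>w' x\<bar> \<le> B'" and e: "\<And>x. \<bar>w x - w' x\<bar> \<le> e"
  shows "\<bar>raise_to_\<Delta> w x - raise_to_\<Delta> w' x\<bar> \<le> 2 * e"
proof -
  have le: "(SUP (y, z). dist y z - v y - v z) \<le> (SUP (y, z). dist y z - v' y - v' z) + 2 * e"
    if v': "\<And>x. \<bar>v' x\<bar> \<le> D" and diff: "\<And>x. \<bar>v x - v' x\<bar> \<le> e" for v v' :: "'a \<Rightarrow> real" and D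
  proof (rule cSUP_least, simp, clarify)
    fix y z
    show "dist y z - v y - v z \<le> (SUP (y, z). dist y z - v' y - v' z) + 2 * e"
      using defect_upper[of v' D y z] v' diff[of y] diff[of z] by (simp add: abs_le_iff)
  qed
  have e': "\<bar>w' x - w x\<bar> \<le> e" for x
    using e[of x] by (simp add: abs_minus_commute)
  have "(SUP (y, z). dist y z - w y - w z) \<le> (SUP (y, z). dist y z - w' y - w' z) + 2 * e"
    and "(SUP (y, z). dist y z - w' y - w' z) \<le> (SUP (y, z). dist y z - w y - w z) + 2 * e"
    using le[of w' B' w] le[of w B w'] B B' e e' by blast+
  then show ?thesis
    using e[of x] unfolding raise_to_\<Delta>_def abs_le_iff by linarith
qed

end

lemma raise_to_\<Delta>_isometry:
  assumes "surj \<phi>" and "\<And>x y. dist (\<phi> x) (\<phi> y) = dist x y"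
  shows "raise_to_\<Delta> (\<lambda>x. w (\<phi> x)) x = raise_to_\<Delta> w (\<phi> x)"
proof -
  have "(\<lambda>(y, z). dist y z - w (\<phi> y) - w (\<phi> z)) =
      (\<lambda>(y, z). dist y z - w y - w z) \<circ> map_prod \<phi> \<phi>"
    by (auto simp: fun_eq_iff assms(2))
  moreover have "range (map_prod \<phi> \<phi>) = UNIV"
    using map_prod_surj[OF assms(1,1)] by simp
  ultimately have "(SUP (y, z). dist y z - w (\<phi> y) - w (\<phi> z)) = (SUP (y, z). dist y z - w y - w z)"
    by (simp only: image_comp[symmetric])
  then show ?thesis
    by (simp add: raise_to_\<Delta>_def)
qed

text \<open>
  Since the coordinates sum to 1, the sum of their squares is at most the
  largest coordinate, so the deepest valley has depth at least \<open>C\<close>. Dividing by the largest coordinate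
  would serve the same purpose, but a quotient of polynomials is visibly continuous.
\<close>

definition valley :: "real \<Rightarrow> ('a \<Rightarrow> real) \<Rightarrow> 'a \<Rightarrow> real"
  where "valley C u = (\<lambda>x. - C * u x / (\<Sum>y | u y \<noteq> 0. (u y)\<^sup>2))"

lemma VR_sum_squares_pos:
  assumes "u \<in> topspace (VR r)"
  shows "0 < (\<Sum>y | u y \<noteq> 0. (u y)\<^sup>2)"
  by (rule sum_pos) (use VR_topspaceD(2,3)[OF assms] in auto)

lemma abs_valley_le:
  assumes "u \<in> topspace (VR r)"
  shows "\<bar>valley C u x\<bar> \<le> \<bar>C\<bar> / (\<Sum>y | u y \<noteq> 0. (u y)\<^sup>2)"
proof -
  note D = VR_topspaceD[OF assms]
  have "u x \<le> 1"
  proof (cases "u x = 0")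
    case False
    then have "u x \<le> (\<Sum>y | u y \<noteq> 0. u y)"
      using D(1,2) by (intro member_le_sum) auto
    then show ?thesis
      using D(4) by simp
  qed simp
  then have "\<bar>C\<bar> * u x \<le> \<bar>C\<bar>"
    using D(1)[of x] by (simp add: mult_left_le)
  then show ?thesis
    using VR_sum_squares_pos[OF assms] D(1)[of x]
    by (simp add: valley_def abs_mult divide_right_mono)
qed

text \<open>
  The witness \<open>x\<close> is a vertex with the largest coordinate. A pair of vertices in the support contributes
  at most their distance to the constant, measured from the bottom of the deepest valley. A
  pair with a point outside the support contributes nothing positive, because one of the two
  valleys is missing and the deepest one has depth at least \<open>C\<close>, which bounds all distances.
\<close>

lemma ex_raise_valley_less:
  fixes u :: "'a :: metric_space \<Rightarrow> real"
  assumes u: "u \<in> topspace (VR (2 * r))" and C: "0 < C" "\<And>x y :: 'a. dist x y \<le> C"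
  shows "\<exists>x. raise_to_\<Delta> (valley C u) x < r"
proof -
  note D = VR_topspaceD[OF u]
  define S where "S = (\<Sum>y | u y \<noteq> 0. (u y)\<^sup>2)"
  have "0 < S"
    using VR_sum_squares_pos[OF u] by (simp add: S_def)
  have valley: "valley C u y = - (C * (u y / S))" for y
    by (simp add: valley_def S_def)
  have "Max (u ` {x. u x \<noteq> 0}) \<in> u ` {x. u x \<noteq> 0}"
    using D(2,3) by (intro Max_in) simp_all
  then obtain x where x: "Max (u ` {x. u x \<noteq> 0}) = u x"
    by auto
  have max: "u y \<le> u x" for y
  proof (cases "u y = 0")
    case False
    then show ?thesis
      unfolding x[symmetric] using D(2) by (intro Max_ge) simp_all
  qed (simp add: D(1))
  have "S \<le> (\<Sum>y | u y \<noteq> 0. u y * u x)"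
    unfolding S_def power2_eq_square by (intro sum_mono mult_left_mono max D(1))
  also have "\<dots> = u x"
    using D(4) by (simp flip: sum_distrib_right)
  finally have "C \<le> C * (u x / S)"
    using \<open>0 < S\<close> C(1) by (simp add: field_simps)
  then have deep: "C \<le> - valley C u x"
    by (simp add: valley)
  have deepest: "- valley C u y \<le> - valley C u x" for y
    using max[of y] \<open>0 < S\<close> C(1) by (simp add: valley divide_right_mono)
  have "0 \<le> diameter {x. u x \<noteq> 0}"
    by (rule diameter_ge_0[OF finite_imp_bounded[OF D(2)]])
  have "dist y z - valley C u y - valley C u z \<le> diameter {x. u x \<noteq> 0} - 2 * valley C u x" for y z
  proof (cases "u y = 0 \<or> u z = 0")
    case True
    then have "- valley C u y - valley C u z \<le> - valley C u x"
      using deepest[of y] deepest[of z] by (auto simp: valley)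
    then show ?thesis
      using deep C(2)[of y z] \<open>0 \<le> diameter {x. u x \<noteq> 0}\<close> by linarith
  next
    case False
    then have "dist y z \<le> diameter {x. u x \<noteq> 0}"
      using finite_imp_bounded[OF D(2)] by (intro diameter_bounded_bound) auto
    then show ?thesis
      using deepest[of y] deepest[of z] by linarith
  qed
  then have "raise_to_\<Delta> (valley C u) x \<le> valley C u x + (diameter {x. u x \<noteq> 0} - 2 * valley C u x) / 2"
    by (rule raise_to_\<Delta>_le)
  also have "\<dots> < r"
    using D(5) by (simp add: field_simps)
  finally show ?thesis
    by blast
qed

text \<open>
  On a closed simplex only finitely many values of \<open>valley\<close> vary, and each does so continuously; the
  Lipschitz estimates for raising and retracting transfer this to the sup-distance.
\<close>

lemma (in G_metric_space) ex_G_map_VR_tight_span_nbhd: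
  assumes "compact (UNIV :: 'a set)"
  shows "\<exists>f. G_map G (VR (2 * r)) (VR_action \<alpha>) (tight_span_nbhd r) (tight_span_action G \<alpha>) f"
proof -
  have bounded: "bounded (UNIV :: 'a set)"
    using assms by (rule compact_imp_bounded)
  obtain C where C: "0 < C" "\<And>x y :: 'a. dist x y \<le> C"
    using bounded_dist[OF bounded] by metis
  define F where "F u = tight_retract (raise_to_\<Delta> (valley C u))" for u :: "'a \<Rightarrow> real"
  have raise: "raise_to_\<Delta> (valley C u) \<in> \<Delta>_set" if "u \<in> topspace (VR (2 * r))" for u :: "'a \<Rightarrow> real"
    by (rule raise_to_\<Delta>_in_\<Delta>_set[OF bounded abs_valley_le[OF that]])
  have tight: "F u \<in> tight_span" if "u \<in> topspace (VR (2 * r))" for u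
    unfolding F_def by (rule tight_retract_in_tight_span[OF bounded raise[OF that]])
  then have Linf: "F u \<in> mspace Linf" if "u \<in> topspace (VR (2 * r))" for u
    using that by (auto simp: tight_span_def \<Delta>_set_def)
  have near: "\<exists>x. F u x < r" if u: "u \<in> topspace (VR (2 * r))" for u
  proof -
    obtain x where "raise_to_\<Delta> (valley C u) x < r"
      using ex_raise_valley_less[OF u C] by blast
    then have "F u x < r"
      using tight_retract_le[OF bounded raise[OF u], of x] by (simp add: F_def)
    then show ?thesis
      by blast
  qed
  have lip: "mdist Linf (F u) (F v) \<le> 2 * e"
    if u: "u \<in> topspace (VR (2 * r))" and v: "v \<in> topspace (VR (2 * r))"
      and e: "\<And>x. \<bar>valley C u x - valley C v x\<bar> \<le> e" for u v e
  proof (rule mdist_Linf_le[OF Linf[OF u] Linf[OF v]])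
    have "\<bar>raise_to_\<Delta> (valley C u) x - raise_to_\<Delta> (valley C v) x\<bar> \<le> 2 * e" for x
      by (rule raise_to_\<Delta>_lipschitz[OF bounded abs_valley_le[OF u] abs_valley_le[OF v] e])
    then show "\<bar>F u x - F v x\<bar> \<le> 2 * e" for x
      unfolding F_def by (rule tight_retract_nonexpansive[OF bounded raise[OF u] raise[OF v]])
  qed
  have "continuous_map (VR (2 * r)) (mtopology_of Linf) F"
    unfolding VR_def
  proof (rule continuous_map_from_realization)
    fix \<sigma> :: "'a set" assume \<sigma>: "\<sigma> \<in> VR_complex (2 * r)"
    then have sub: "u \<in> topspace (VR (2 * r))" if "u \<in> closed_simplex \<sigma>" for u
      using that by (auto simp: VR_def topspace_geometric_realization)
    have "finite \<sigma>"
      using \<sigma> by (simp add: VR_complex_def)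
    have supp: "(\<Sum>y | u y \<noteq> 0. (u y)\<^sup>2) = (\<Sum>y\<in>\<sigma>. (u y)\<^sup>2)" if "u \<in> closed_simplex \<sigma>" for u
      by (rule sum.mono_neutral_left) (use that \<open>finite \<sigma>\<close> in \<open>auto simp: closed_simplex_def\<close>)
    have coord: "continuous_on (closed_simplex \<sigma>) (\<lambda>u. u x)" for x
      by (rule continuous_on_subset[OF continuous_on_product_coordinates]) simp
    have quot: "continuous_on (closed_simplex \<sigma>) (\<lambda>u. - C * u x / (\<Sum>y\<in>\<sigma>. (u y)\<^sup>2))" for x
    proof (intro continuous_on_divide continuous_on_mult_left continuous_on_sum continuous_on_power coord ballI)
      fix u assume "u \<in> closed_simplex \<sigma>"
      then show "(\<Sum>y\<in>\<sigma>. (u y)\<^sup>2) \<noteq> 0"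
        using VR_sum_squares_pos[OF sub] supp by force
    qed
    have cont: "continuous_on (closed_simplex \<sigma>) (\<lambda>u. valley C u x)" for x
      by (rule continuous_on_eq[OF quot[of x]]) (simp add: valley_def supp)
    interpret L: Metric_space "mspace Linf" "mdist Linf" by (rule Metric_space_mspace_mdist)
    show "continuous_map (top_of_set (closed_simplex \<sigma>)) (mtopology_of Linf) F"
      unfolding mtopology_of_def L.continuous_map_to_metric
    proof (intro ballI allI impI)
      fix u and e :: real
      assume "u \<in> topspace (top_of_set (closed_simplex \<sigma>))" and "0 < e"
      then have u: "u \<in> closed_simplex \<sigma>" by simp
      define D where "D v = (\<Sum>x\<in>\<sigma>. \<bar>valley C u x - valley C v x\<bar>)" for v
      define U where "U = {v \<in> topspace (top_of_set (closed_simplex \<sigma>)). D v \<in> {..< e / 2}}"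
      have "continuous_map (top_of_set (closed_simplex \<sigma>)) euclideanreal D"
        unfolding D_def by (simp, intro continuous_on_sum continuous_on_rabs continuous_on_diff
            continuous_on_const cont)
      then have "openin (top_of_set (closed_simplex \<sigma>)) U"
        unfolding U_def by (rule openin_continuous_map_preimage) simp
      moreover have "u \<in> U"
        using u \<open>0 < e\<close> by (simp add: U_def D_def)
      moreover have "F v \<in> L.mball (F u) e" if "v \<in> U" for v
      proof -
        have v: "v \<in> closed_simplex \<sigma>" "D v < e / 2"
          using that by (auto simp: U_def)
        have "\<bar>valley C u x - valley C v x\<bar> \<le> D v" for x
        proof (cases "x \<in> \<sigma>")
          case True
          then show ?thesis
            unfolding D_def using \<open>finite \<sigma>\<close> by (intro member_le_sum) auto
        next
          case False
          then show ?thesis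
            using u v(1) by (simp add: valley_def closed_simplex_def D_def sum_nonneg)
        qed
        then have "mdist Linf (F u) (F v) \<le> 2 * D v"
          by (rule lip[OF sub[OF u] sub[OF v(1)]])
        then show ?thesis
          using Linf[OF sub[OF u]] Linf[OF sub[OF v(1)]] v(2) by simp
      qed
      ultimately show "\<exists>U. openin (top_of_set (closed_simplex \<sigma>)) U \<and> u \<in> U \<and> (\<forall>v\<in>U. F v \<in> L.mball (F u) e)"
        by blast
    qed
  qed
  then have "continuous_map (VR (2 * r)) (tight_span_nbhd r) F"
    unfolding tight_span_nbhd_eq[OF bounded]
    by (rule continuous_map_into_subtopology) (use tight near in auto)
  moreover have "F (VR_action \<alpha> g u) = tight_span_action G \<alpha> g (F u)"
    if g: "g \<in> carrier G" for g u
  proof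
    fix x
    let ?\<phi> = "\<alpha> (inv g)"
    have \<phi>: "surj ?\<phi>" "dist (?\<phi> y) (?\<phi> z) = dist y z" for y z
      using surj_act isometry g by simp_all
    have u: "VR_action \<alpha> g u = (\<lambda>x. u (?\<phi> x))"
      using g by (simp add: fun_eq_iff VR_action_apply)
    have "(\<Sum>y | u (?\<phi> y) \<noteq> 0. (u (?\<phi> y))\<^sup>2) = (\<Sum>y | u y \<noteq> 0. (u y)\<^sup>2)"
      by (rule sum.reindex_bij_witness[where i = "\<alpha> g" and j = ?\<phi>]) (use g in auto)
    then have valley: "valley C (VR_action \<alpha> g u) = (\<lambda>x. valley C u (?\<phi> x))"
      by (simp add: valley_def u)
    have "raise_to_\<Delta> (valley C (VR_action \<alpha> g u)) = (\<lambda>x. raise_to_\<Delta> (valley C u) (?\<phi> x))"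
      unfolding valley by (rule ext, rule raise_to_\<Delta>_isometry[OF \<phi>])
    then show "F (VR_action \<alpha> g u) x = tight_span_action G \<alpha> g (F u) x"
      unfolding F_def tight_span_action_def by (simp only: tight_retract_isometry[OF \<phi>])
  qed
  ultimately show ?thesis
    unfolding G_map_def by blast
qed

section \<open>From the tight span to the Vietoris--Rips complex\<close>

text \<open>
  Encodes a sequence of finer and finer finite invariant nets as one function: \<open>level x\<close> is the mesh
  \<open>1/(n+1)\<close> of the first net that contains \<open>x\<close>, and \<open>0\<close> if there is none. Points of level above \<open>s/2\<close> form an \<open>s\<close>-net, and only
  finitely many points have level at least \<open>s\<close>.
\<close>

lemma (in G_metric_space) ex_invariant_level:
  assumes "finite (carrier G)" and "compact (UNIV :: 'a set)"
  shows "\<exists>level :: 'a \<Rightarrow> real. (\<forall>g\<in>carrier G. \<forall>x. level (\<alpha> g x) = level x) \<and>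
    (\<forall>s>0. finite {x. s \<le> level x}) \<and> (\<forall>s y. 0 < s \<and> s \<le> 1 \<longrightarrow> (\<exists>x. s < 2 * level x \<and> dist x y < s))"
proof -
  have "\<forall>n. \<exists>N. finite N \<and> (\<forall>g\<in>carrier G. \<forall>x\<in>N. \<alpha> g x \<in> N) \<and>
      (\<forall>y. \<exists>x\<in>N. dist x y < 1 / real (Suc n))"
    using ex_invariant_net[OF assms] by simp
  then obtain N where fin: "\<And>n. finite (N n)"
    and inv: "\<And>n g x. g \<in> carrier G \<Longrightarrow> x \<in> N n \<Longrightarrow> \<alpha> g x \<in> N n"
    and dense: "\<And>n y. \<exists>x\<in>N n. dist x y < 1 / real (Suc n)"
    by metis
  define level where "level x = (if \<exists>n. x \<in> N n then 1 / real (Suc (LEAST n. x \<in> N n)) else 0)" for x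
  show ?thesis
  proof (intro exI[of _ level] conjI ballI allI impI)
    fix g x assume g: "g \<in> carrier G"
    have "\<alpha> g x \<in> N n \<longleftrightarrow> x \<in> N n" for n
      using inv[OF g, of x n] inv[OF inv_carrier[OF g], of "\<alpha> g x" n] g by auto
    then show "level (\<alpha> g x) = level x"
      by (simp add: level_def)
  next
    fix s :: real assume "0 < s"
    have "{x. s \<le> level x} \<subseteq> (\<Union>n\<in>{n. real n \<le> 1 / s}. N n)"
    proof
      fix x assume "x \<in> {x. s \<le> level x}"
      then have s: "s \<le> level x" by simp
      have ex: "\<exists>n. x \<in> N n"
      proof (rule ccontr)
        assume "\<nexists>n. x \<in> N n"
        then have "level x = 0"
          unfolding level_def by (rule if_not_P)
        with s \<open>0 < s\<close> show False
          by simp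
      qed
      let ?n = "LEAST n. x \<in> N n"
      have "s \<le> 1 / real (Suc ?n)"
        using s ex by (simp add: level_def)
      then have "s * real ?n \<le> 1"
        using \<open>0 < s\<close> by (simp add: field_simps)
      then have "real ?n \<le> 1 / s"
        using \<open>0 < s\<close> by (simp add: field_simps)
      moreover have "x \<in> N ?n"
        using ex by (rule LeastI_ex)
      ultimately show "x \<in> (\<Union>n\<in>{n. real n \<le> 1 / s}. N n)"
        by blast
    qed
    moreover have "{n. real n \<le> 1 / s} \<subseteq> {..nat \<lfloor>1 / s\<rfloor>}"
      by (auto simp: le_nat_floor)
    then have "finite {n. real n \<le> 1 / s}"
      by (rule finite_subset) simp
    ultimately show "finite {x. s \<le> level x}"
      using fin by (meson finite_UN finite_subset)
  next
    fix s :: real and y assume "0 < s \<and> s \<le> 1"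
    then have s: "0 < s" "s \<le> 1" by simp_all
    \<comment> \<open>The mesh of this net lies between s/2 and s: rounding up 1/s at most doubles it, as 1/s is at least 1.\<close>
    define n where "n = nat \<lceil>1 / s\<rceil> - 1"
    have "1 \<le> 1 / s"
      using s by simp
    then have n: "real (Suc n) = of_int \<lceil>1 / s\<rceil>"
      unfolding n_def by linarith
    have "1 / s \<le> real (Suc n)" and "real (Suc n) < 2 / s"
      using \<open>1 \<le> 1 / s\<close> ceiling_correct[of "1 / s"] unfolding n by simp_all
    then have "1 / real (Suc n) \<le> s" and "s < 2 / real (Suc n)"
      using s by (simp_all add: field_simps)
    obtain x where x: "x \<in> N n" "dist x y < 1 / real (Suc n)"
      using dense by blast
    have "(LEAST n. x \<in> N n) \<le> n"
      using x(1) by (rule Least_le)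
    then have "1 / real (Suc n) \<le> level x"
      using x(1) by (auto simp: level_def intro!: divide_left_mono)
    then have "s < 2 * level x"
      using \<open>s < 2 / real (Suc n)\<close> by simp
    moreover have "dist x y < s"
      using x(2) \<open>1 / real (Suc n) \<le> s\<close> by linarith
    ultimately show "\<exists>x. s < 2 * level x \<and> dist x y < s"
      by blast
  qed
qed

lemma continuous_map_Linf_eval: "continuous_map (mtopology_of Linf) euclideanreal (\<lambda>f. f x)"
proof -
  have "Lipschitz_continuous_map Linf euclidean_metric (\<lambda>f. f x :: real)"
    unfolding Lipschitz_continuous_map_def
    by (auto intro!: exI[of _ 1] abs_diff_le_mdist_Linf simp: dist_real_def simp del: mdist_funspace)
  then show ?thesis
    using Lipschitz_continuous_imp_continuous_map by fastforce
qed

lemma continuous_map_Linf_INF: "continuous_map (mtopology_of Linf) euclideanreal (\<lambda>f. INF x. f x)"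
proof -
  have le: "(INF x. f x) \<le> (INF x. g x) + mdist Linf f g"
    if f: "f \<in> mspace Linf" and g: "g \<in> mspace Linf" for f g :: "'a \<Rightarrow> real"
  proof -
    have "(INF x. f x) - mdist Linf f g \<le> (INF x. g x)"
    proof (rule cINF_greatest)
      fix x
      have "bdd_below (range f)"
        using f unfolding mspace_Linf by (rule bounded_imp_bdd_below)
      then have "(INF x. f x) \<le> f x"
        by (rule cINF_lower) simp
      then show "(INF x. f x) - mdist Linf f g \<le> g x"
        using abs_diff_le_mdist_Linf[OF f g, of x] by linarith
    qed simp
    then show ?thesis
      by simp
  qed
  have "\<bar>(INF x. f x) - (INF x. g x)\<bar> \<le> mdist Linf f g"
    if "f \<in> mspace Linf" and "g \<in> mspace Linf" for f g :: "'a \<Rightarrow> real"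
    using le[OF that] le[OF that(2,1)] mdist_commute[of Linf f g] by linarith
  then have "Lipschitz_continuous_map Linf euclidean_metric (\<lambda>f :: 'a \<Rightarrow> real. INF x. f x)"
    unfolding Lipschitz_continuous_map_def
    by (auto intro!: exI[of _ 1] simp: dist_real_def simp del: mdist_funspace)
  then show ?thesis
    using Lipschitz_continuous_imp_continuous_map by fastforce
qed

text \<open>
  A fixed finite net would miss functions \<open>f\<close> whose infimum is close to \<open>r\<close>. So the mesh is adapted to
  the room \<open>slack f\<close> that \<open>f\<close> leaves below \<open>r\<close>: points of level at most \<open>slack f / 2\<close> are switched off
  continuously, which keeps the supports locally finite, and those of higher level still
  include a point so close to a minimum of \<open>f\<close> that \<open>f\<close> is below \<open>r\<close> there. In this way
  no scale is lost, in contrast to the map from measures.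
\<close>

lemma (in G_metric_space) ex_G_map_tight_span_nbhd_VR:
  assumes "finite (carrier G)" and "compact (UNIV :: 'a set)"
  shows "\<exists>f. G_map G (tight_span_nbhd r) (tight_span_action G \<alpha>) (VR (2 * r)) (VR_action \<alpha>) f"
proof -
  have bounded: "bounded (UNIV :: 'a set)"
    using assms(2) by (rule compact_imp_bounded)
  obtain level :: "'a \<Rightarrow> real"
    where inv: "\<And>g x. g \<in> carrier G \<Longrightarrow> level (\<alpha> g x) = level x"
      and fin: "\<And>s. 0 < s \<Longrightarrow> finite {x. s \<le> level x}"
      and dense: "\<And>s y. 0 < s \<Longrightarrow> s \<le> 1 \<Longrightarrow> \<exists>x. s < 2 * level x \<and> dist x y < s"
    using ex_invariant_level[OF assms] by metis
  let ?S = "tight_span_nbhd r :: ('a \<Rightarrow> real) topology"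
  \<comment> \<open>Truncated at 1 because the coarsest net has mesh 1.\<close>
  define slack where "slack f = min 1 (r - (INF x. f x))" for f :: "'a \<Rightarrow> real"
  define F where "F f x = max 0 (r - f x) * max 0 (2 * level x - slack f)" for f x
  have nonzero: "f x < r" "slack f < 2 * level x" if "F f x \<noteq> 0" for f x
    using that by (auto simp: F_def max_def split: if_splits)
  have cont_slack: "continuous_map ?S euclideanreal slack"
    unfolding slack_def tight_span_nbhd_def
    by (intro continuous_map_real_min continuous_map_diff continuous_map_const[THEN iffD2]
        continuous_map_from_subtopology continuous_map_Linf_INF) simp_all
  have inf: "\<exists>y. f y = (INF x. f x) \<and> f y < r" if f: "f \<in> topspace ?S" for f
  proof -
    have tight: "f \<in> tight_span" and near: "\<exists>x. f x < r"
      using f by (simp_all add: topspace_tight_span_nbhd[OF bounded])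
    have "\<bar>f x - f y\<bar> \<le> dist x y" for x y
      using tight_span_lipschitz[OF bounded tight, of x y] tight_span_lipschitz[OF bounded tight, of y x]
      by (simp add: abs_le_iff dist_commute)
    then have "1-lipschitz_on UNIV f"
      by (intro lipschitz_onI) (simp_all add: dist_real_def)
    then have "continuous_on UNIV f"
      by (rule lipschitz_on_continuous_on)
    then obtain y where y: "\<And>x. f y \<le> f x"
      using continuous_attains_inf[OF assms(2)] by auto
    have "(INF x. f x) = f y"
      using y by (intro cInf_eq_minimum) auto
    moreover have "f y < r"
      using near y le_less_trans by blast
    ultimately show ?thesis
      by auto
  qed
  have slack_pos: "0 < slack f" if "f \<in> topspace ?S" for f
    using inf[OF that] by (auto simp: slack_def)
  have "G_map G ?S (tight_span_action G \<alpha>) (VR (2 * r)) (VR_action \<alpha>) (\<lambda>f. normalized (F f))"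
  proof (rule G_map_to_VR)
    fix f assume f: "f \<in> topspace ?S"
    have tight: "f \<in> tight_span"
      using f by (simp add: topspace_tight_span_nbhd[OF bounded])
    show "0 \<le> F f x" for x
      by (simp add: F_def)
    obtain y where y: "f y = (INF x. f x)" "f y < r"
      using inf[OF f] by blast
    obtain x where x: "slack f < 2 * level x" "dist x y < slack f"
      using dense[OF slack_pos[OF f], of y] by (auto simp: slack_def)
    have "slack f \<le> r - f y"
      by (simp add: slack_def y(1))
    then have "f x < r"
      using tight_span_lipschitz[OF bounded tight, of x y] x(2) by linarith
    with x(1) show "\<exists>x. F f x \<noteq> 0"
      by (intro exI[of _ x]) (simp add: F_def)
    show "dist x x' < 2 * r" if "F f x \<noteq> 0" "F f x' \<noteq> 0" for x x'
      using \<Delta>_setD(1)[of f x x'] tight nonzero(1)[OF that(1)] nonzero(1)[OF that(2)]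
      by (simp add: tight_span_def)
    show "\<exists>V N. openin ?S V \<and> f \<in> V \<and> finite N \<and> (\<forall>h\<in>V. {x. F h x \<noteq> 0} \<subseteq> N)"
    proof (intro exI conjI ballI)
      show "openin ?S {h \<in> topspace ?S. slack h \<in> {slack f / 2 <..}}"
        using cont_slack by (rule openin_continuous_map_preimage) simp
      show "f \<in> {h \<in> topspace ?S. slack h \<in> {slack f / 2 <..}}"
        using f slack_pos[OF f] by simp
      show "finite {x. slack f / 4 \<le> level x}"
        using slack_pos[OF f] by (intro fin) simp
      fix h assume "h \<in> {h \<in> topspace ?S. slack h \<in> {slack f / 2 <..}}"
      then have h: "slack f / 2 < slack h" by simp
      show "{x. F h x \<noteq> 0} \<subseteq> {x. slack f / 4 \<le> level x}"
      proof
        fix x assume "x \<in> {x. F h x \<noteq> 0}"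
        then show "x \<in> {x. slack f / 4 \<le> level x}"
          using nonzero(2)[of h x] h by simp
      qed
    qed
    show "F (tight_span_action G \<alpha> g f) x = F f (\<alpha> (inv g) x)" if g: "g \<in> carrier G" for g x
    proof -
      have "(INF x. f (\<alpha> (inv g) x)) = (INF x\<in>range (\<alpha> (inv g)). f x)"
        by (simp add: image_image)
      then have "slack (tight_span_action G \<alpha> g f) = slack f"
        using g by (simp add: slack_def tight_span_action_def surj_act)
      then show ?thesis
        using g inv[of "inv g" x] by (simp add: F_def tight_span_action_def)
    qed
  next
    show "continuous_map ?S euclideanreal (\<lambda>f. F f x)" for x
    proof -
      have "continuous_map ?S euclideanreal (\<lambda>f. f x)"
        unfolding tight_span_nbhd_def
        by (intro continuous_map_from_subtopology continuous_map_Linf_eval)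
      then show ?thesis
        unfolding F_def
        by (intro continuous_map_real_mult continuous_map_real_max continuous_map_diff cont_slack) simp_all
    qed
  qed
  then show ?thesis
    by blast
qed

section \<open>Comparison of the indices\<close>

text \<open>
  Converts maps into an inequality: if every map to scale \<open>\<epsilon> + \<eta>\<close> yields maps whose excess is
  \<open>c * \<eta> + d\<close> up to an arbitrarily small error, then the indices are related in the same
  way.
\<close>

lemma G_index_le:
  assumes "0 < c"
    and step: "\<And>\<eta> e f. 0 < \<eta> \<Longrightarrow> 0 < e \<Longrightarrow> G_map G S \<sigma> (T (\<epsilon> + \<eta>)) \<tau> f \<Longrightarrow>
      \<exists>\<eta>' h. 0 < \<eta>' \<and> \<eta>' \<le> c * \<eta> + d + e \<and> G_map G S' \<sigma>' (T' (\<epsilon>' + \<eta>')) \<tau>' h"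
  shows "G_index G S' \<sigma>' T' \<tau>' \<epsilon>' \<le> ereal c * G_index G S \<sigma> T \<tau> \<epsilon> + ereal d"
proof -
  let ?I = "G_index G S' \<sigma>' T' \<tau>' \<epsilon>'"
  have "(?I - ereal d) / ereal c \<le> ereal \<eta>" if "0 < \<eta>" and f: "G_map G S \<sigma> (T (\<epsilon> + \<eta>)) \<tau> f" for \<eta> f
  proof -
    have "?I \<le> ereal (c * \<eta> + d) + ereal e" if "0 < e" for e
    proof -
      obtain \<eta>' h where \<eta>': "0 < \<eta>'" "\<eta>' \<le> c * \<eta> + d + e" "G_map G S' \<sigma>' (T' (\<epsilon>' + \<eta>')) \<tau>' h"
        using step[OF \<open>0 < \<eta>\<close> \<open>0 < e\<close> f] by blast
      then have "?I \<le> ereal \<eta>'"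
        unfolding G_index_def by (intro Inf_lower) blast
      also have "\<dots> \<le> ereal (c * \<eta> + d) + ereal e"
        using \<eta>'(2) by simp
      finally show ?thesis .
    qed
    then have "?I \<le> ereal (c * \<eta> + d)"
      by (rule ereal_le_epsilon2)
    then have "?I - ereal d \<le> ereal c * ereal \<eta>"
      by (simp add: ereal_minus_le)
    then show ?thesis
      using \<open>0 < c\<close> by (simp add: ereal_divide_le_pos)
  qed
  then have "(?I - ereal d) / ereal c \<le> G_index G S \<sigma> T \<tau> \<epsilon>"
    unfolding G_index_def[of G S \<sigma> T \<tau> \<epsilon>] by (intro Inf_greatest) blast
  then have "?I - ereal d \<le> ereal c * G_index G S \<sigma> T \<tau> \<epsilon>"
    using \<open>0 < c\<close> by (simp add: ereal_divide_le_pos)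
  then show ?thesis
    by (simp add: ereal_minus_le)
qed

lemma c_VR_le_c_infty:
  fixes \<alpha>X :: "'g \<Rightarrow> 'a \<Rightarrow> 'a :: metric_space"
  assumes "finite (carrier G)" and "G_metric_space G \<alpha>X" and "compact (UNIV :: 'a set)"
    and "G_metric_space G \<alpha>Y"
  shows "c_VR G \<alpha>X \<alpha>Y \<epsilon> \<le> c_infty G \<alpha>X \<alpha>Y \<epsilon>"
proof -
  interpret X: G_metric_space G \<alpha>X by fact
  interpret Y: G_metric_space G \<alpha>Y by fact
  have thicken: "\<exists>\<eta>' h. 0 < \<eta>' \<and> \<eta>' \<le> 1 * \<eta> + 0 + e \<and> G_map G S \<sigma> (VR (\<epsilon> + \<eta>')) (VR_action \<alpha>X) h"
    if pos: "0 < \<eta>" "0 < e" and f: "G_map G S \<sigma> (VRm (\<epsilon> + \<eta>)) (VRm_action \<alpha>X) f"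
    for \<eta> e f and S :: "'s topology" and \<sigma>
  proof -
    obtain p where "G_map G (VRm (\<epsilon> + \<eta>)) (VRm_action \<alpha>X) (VR (\<epsilon> + \<eta> + e)) (VR_action \<alpha>X) p"
      using X.ex_G_map_VRm_VR[OF assms(1,3) pos(2)] by blast
    then have "G_map G S \<sigma> (VR (\<epsilon> + (\<eta> + e))) (VR_action \<alpha>X) (p \<circ> f)"
      unfolding add.assoc by (rule G_map_comp[OF f])
    with pos show ?thesis
      by (intro exI[of _ "\<eta> + e"] exI[of _ "p \<circ> f"]) simp
  qed
  have "G_index G euclidean \<alpha>Y VR (VR_action \<alpha>X) \<epsilon>
      \<le> ereal 1 * G_index G euclidean \<alpha>Y VRm (VRm_action \<alpha>X) \<epsilon> + ereal 0"
    by (rule G_index_le[OF zero_less_one thicken])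
  moreover have "G_index G (VR \<epsilon>) (VR_action \<alpha>Y) VR (VR_action \<alpha>X) \<epsilon>
      \<le> ereal 1 * G_index G (VRm \<epsilon>) (VRm_action \<alpha>Y) VRm (VRm_action \<alpha>X) \<epsilon> + ereal 0"
    by (rule G_index_le[OF zero_less_one thicken[OF _ _ G_map_comp[OF Y.G_map_VR_VRm]]])
  ultimately show ?thesis
    by (cases "\<epsilon> = 0") (simp_all add: c_VR_def c_infty_def)
qed

lemma c_infty_zero_le_c_VR_zero:
  assumes "G_metric_space G \<alpha>X"
  shows "c_infty G \<alpha>X \<alpha>Y 0 \<le> c_VR G \<alpha>X \<alpha>Y 0"
proof -
  interpret X: G_metric_space G \<alpha>X by fact
  have "G_index G euclidean \<alpha>Y VRm (VRm_action \<alpha>X) 0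
      \<le> ereal 1 * G_index G euclidean \<alpha>Y VR (VR_action \<alpha>X) 0 + ereal 0"
  proof (rule G_index_le[OF zero_less_one])
    fix \<eta> e :: real and f
    assume pos: "0 < \<eta>" "0 < e" and f: "G_map G euclidean \<alpha>Y (VR (0 + \<eta>)) (VR_action \<alpha>X) f"
    show "\<exists>\<eta>' h. 0 < \<eta>' \<and> \<eta>' \<le> 1 * \<eta> + 0 + e \<and>
        G_map G euclidean \<alpha>Y (VRm (0 + \<eta>')) (VRm_action \<alpha>X) h"
      using pos G_map_comp[OF f X.G_map_VR_VRm]
      by (intro exI[of _ \<eta>] exI[of _ "atomic_measure \<circ> f"]) simp
  qed
  then show ?thesis
    by (simp add: c_VR_def c_infty_def)
qed

lemma c_infty_le_c_VR_shifted:
  fixes \<alpha>Y :: "'g \<Rightarrow> 'b \<Rightarrow> 'b :: metric_space"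
  assumes "finite (carrier G)" and "G_metric_space G \<alpha>X"
    and "G_metric_space G \<alpha>Y" and "compact (UNIV :: 'b set)"
    and pos: "0 < \<epsilon>" "0 < \<delta>"
  shows "c_infty G \<alpha>X \<alpha>Y \<epsilon> \<le> c_VR G \<alpha>X \<alpha>Y (\<epsilon> + \<delta>) + ereal \<delta>"
proof -
  interpret X: G_metric_space G \<alpha>X by fact
  interpret Y: G_metric_space G \<alpha>Y by fact
  obtain p where p: "G_map G (VRm \<epsilon>) (VRm_action \<alpha>Y) (VR (\<epsilon> + \<delta>)) (VR_action \<alpha>Y) p"
    using Y.ex_G_map_VRm_VR[OF assms(1,4) pos(2)] by blast
  have "G_index G (VRm \<epsilon>) (VRm_action \<alpha>Y) VRm (VRm_action \<alpha>X) \<epsilon>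
      \<le> ereal 1 * G_index G (VR (\<epsilon> + \<delta>)) (VR_action \<alpha>Y) VR (VR_action \<alpha>X) (\<epsilon> + \<delta>) + ereal \<delta>"
  proof (rule G_index_le[OF zero_less_one])
    fix \<eta> e :: real and f
    assume "0 < \<eta>" "0 < e"
      and f: "G_map G (VR (\<epsilon> + \<delta>)) (VR_action \<alpha>Y) (VR (\<epsilon> + \<delta> + \<eta>)) (VR_action \<alpha>X) f"
    have "G_map G (VRm \<epsilon>) (VRm_action \<alpha>Y) (VRm (\<epsilon> + (\<delta> + \<eta>))) (VRm_action \<alpha>X)
        (atomic_measure \<circ> (f \<circ> p))"
      using G_map_comp[OF G_map_comp[OF p f] X.G_map_VR_VRm] by (simp add: add.assoc)
    then show "\<exists>\<eta>' h. 0 < \<eta>' \<and> \<eta>' \<le> 1 * \<eta> + \<delta> + e \<and>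
        G_map G (VRm \<epsilon>) (VRm_action \<alpha>Y) (VRm (\<epsilon> + \<eta>')) (VRm_action \<alpha>X) h"
      using \<open>0 < \<eta>\<close> \<open>0 < e\<close> pos(2)
      by (intro exI[of _ "\<delta> + \<eta>"] exI[of _ "atomic_measure \<circ> (f \<circ> p)"]) simp
  qed
  then show ?thesis
    using pos by (simp add: c_VR_def c_infty_def)
qed

text \<open>
  For \<open>\<epsilon> = 0\<close> the source of the maps is the space \<open>Y\<close> itself; otherwise it is a thickening of \<open>Y\<close>, and
  the maps between the complex and the tight span of \<open>Y\<close>, which lose no scale, exchange the sources.
\<close>

lemma c_VR_double_eq_double_c_E:
  fixes \<alpha>X :: "'g \<Rightarrow> 'a \<Rightarrow> 'a :: metric_space" and \<alpha>Y :: "'g \<Rightarrow> 'b \<Rightarrow> 'b :: metric_space"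
  assumes "finite (carrier G)" and "G_metric_space G \<alpha>X" and "compact (UNIV :: 'a set)"
    and "G_metric_space G \<alpha>Y" and "compact (UNIV :: 'b set)"
  shows "c_VR G \<alpha>X \<alpha>Y (2 * \<epsilon>) = 2 * c_E G \<alpha>X \<alpha>Y \<epsilon>"
proof -
  interpret X: G_metric_space G \<alpha>X by fact
  interpret Y: G_metric_space G \<alpha>Y by fact
  have to_VR: "\<exists>\<eta>' h. 0 < \<eta>' \<and> \<eta>' \<le> 2 * \<eta> + 0 + e \<and> G_map G S \<sigma> (VR (2 * \<epsilon> + \<eta>')) (VR_action \<alpha>X) h"
    if pos: "0 < \<eta>" "0 < e"
      and f: "G_map G S \<sigma> (tight_span_nbhd (\<epsilon> + \<eta>)) (tight_span_action G \<alpha>X) f"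
    for \<eta> e f and S :: "'s topology" and \<sigma>
  proof -
    obtain p where "G_map G (tight_span_nbhd (\<epsilon> + \<eta>)) (tight_span_action G \<alpha>X)
        (VR (2 * (\<epsilon> + \<eta>))) (VR_action \<alpha>X) p"
      using X.ex_G_map_tight_span_nbhd_VR[OF assms(1,3)] by blast
    then have "G_map G S \<sigma> (VR (2 * \<epsilon> + 2 * \<eta>)) (VR_action \<alpha>X) (p \<circ> f)"
      unfolding distrib_left by (rule G_map_comp[OF f])
    with pos show ?thesis
      by (intro exI[of _ "2 * \<eta>"] exI[of _ "p \<circ> f"]) simp
  qed
  have to_E: "\<exists>\<eta>' h. 0 < \<eta>' \<and> \<eta>' \<le> 1 / 2 * \<eta> + 0 + e \<and>
      G_map G S \<sigma> (tight_span_nbhd (\<epsilon> + \<eta>')) (tight_span_action G \<alpha>X) h"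
    if pos: "0 < \<eta>" "0 < e" and f: "G_map G S \<sigma> (VR (2 * \<epsilon> + \<eta>)) (VR_action \<alpha>X) f"
    for \<eta> e f and S :: "'s topology" and \<sigma>
  proof -
    have double: "2 * (\<epsilon> + \<eta> / 2) = 2 * \<epsilon> + \<eta>"
      by simp
    obtain p where "G_map G (VR (2 * \<epsilon> + \<eta>)) (VR_action \<alpha>X)
        (tight_span_nbhd (\<epsilon> + \<eta> / 2)) (tight_span_action G \<alpha>X) p"
      using X.ex_G_map_VR_tight_span_nbhd[OF assms(3), of "\<epsilon> + \<eta> / 2"] unfolding double by blast
    then have "G_map G S \<sigma> (tight_span_nbhd (\<epsilon> + \<eta> / 2)) (tight_span_action G \<alpha>X) (p \<circ> f)"
      by (rule G_map_comp[OF f])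
    with pos show ?thesis
      by (intro exI[of _ "\<eta> / 2"] exI[of _ "p \<circ> f"]) simp
  qed
  obtain p where p: "G_map G (VR (2 * \<epsilon>)) (VR_action \<alpha>Y) (tight_span_nbhd \<epsilon>) (tight_span_action G \<alpha>Y) p"
    using Y.ex_G_map_VR_tight_span_nbhd[OF assms(5)] by blast
  obtain q where q: "G_map G (tight_span_nbhd \<epsilon>) (tight_span_action G \<alpha>Y) (VR (2 * \<epsilon>)) (VR_action \<alpha>Y) q"
    using Y.ex_G_map_tight_span_nbhd_VR[OF assms(1,5)] by blast
  have half: "0 < (1 / 2 :: real)" and two: "0 < (2 :: real)"
    by simp_all
  have "c_VR G \<alpha>X \<alpha>Y (2 * \<epsilon>) \<le> ereal 2 * c_E G \<alpha>X \<alpha>Y \<epsilon> + ereal 0"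
  proof (cases "\<epsilon> = 0")
    case True
    have "G_index G euclidean \<alpha>Y VR (VR_action \<alpha>X) (2 * \<epsilon>) \<le>
        ereal 2 * G_index G euclidean \<alpha>Y tight_span_nbhd (tight_span_action G \<alpha>X) \<epsilon> + ereal 0"
      by (rule G_index_le[OF two to_VR])
    with True show ?thesis
      by (simp add: c_VR_def c_E_def)
  next
    case False
    have "G_index G (VR (2 * \<epsilon>)) (VR_action \<alpha>Y) VR (VR_action \<alpha>X) (2 * \<epsilon>) \<le>
        ereal 2 * G_index G (tight_span_nbhd \<epsilon>) (tight_span_action G \<alpha>Y)
          tight_span_nbhd (tight_span_action G \<alpha>X) \<epsilon> + ereal 0"
      by (rule G_index_le[OF two to_VR[OF _ _ G_map_comp[OF p]]])
    with False show ?thesis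
      by (simp add: c_VR_def c_E_def)
  qed
  moreover have "c_E G \<alpha>X \<alpha>Y \<epsilon> \<le> ereal (1 / 2) * c_VR G \<alpha>X \<alpha>Y (2 * \<epsilon>) + ereal 0"
  proof (cases "\<epsilon> = 0")
    case True
    have "G_index G euclidean \<alpha>Y tight_span_nbhd (tight_span_action G \<alpha>X) \<epsilon> \<le>
        ereal (1 / 2) * G_index G euclidean \<alpha>Y VR (VR_action \<alpha>X) (2 * \<epsilon>) + ereal 0"
      by (rule G_index_le[OF half to_E])
    with True show ?thesis
      by (simp add: c_VR_def c_E_def)
  next
    case False
    have "G_index G (tight_span_nbhd \<epsilon>) (tight_span_action G \<alpha>Y)
          tight_span_nbhd (tight_span_action G \<alpha>X) \<epsilon> \<le>
        ereal (1 / 2) * G_index G (VR (2 * \<epsilon>)) (VR_action \<alpha>Y) VR (VR_action \<alpha>X) (2 * \<epsilon>) + ereal 0"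
      by (rule G_index_le[OF half to_E[OF _ _ G_map_comp[OF q]]])
    with False show ?thesis
      by (simp add: c_VR_def c_E_def)
  qed
  ultimately show ?thesis
    by (cases "c_E G \<alpha>X \<alpha>Y \<epsilon>"; cases "c_VR G \<alpha>X \<alpha>Y (2 * \<epsilon>)") auto
qed

theorem proposition6p2:
  fixes G :: "('g, 'm) monoid_scheme"
    and \<alpha>X :: "'g \<Rightarrow> 'a \<Rightarrow> 'a :: metric_space"
    and \<alpha>Y :: "'g \<Rightarrow> 'b \<Rightarrow> 'b :: metric_space"
  assumes "group G" and "finite (carrier G)"
    and "G_metric_space G \<alpha>X" and "compact (UNIV :: 'a set)"
    and "G_metric_space G \<alpha>Y" and "compact (UNIV :: 'b set)"
  shows
    "c_infty G \<alpha>X \<alpha>Y 0 = c_VR G \<alpha>X \<alpha>Y 0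
     \<and> (\<forall>\<epsilon>>0. c_VR G \<alpha>X \<alpha>Y \<epsilon> \<le> c_infty G \<alpha>X \<alpha>Y \<epsilon>
          \<and> c_infty G \<alpha>X \<alpha>Y \<epsilon> \<le> (INF \<delta>\<in>{0<..}. c_VR G \<alpha>X \<alpha>Y (\<epsilon> + \<delta>) + ereal \<delta>))
     \<and> c_VR G \<alpha>X \<alpha>Y 0 \<le> 2 * c_E G \<alpha>X \<alpha>Y 0
     \<and> (Sep G \<alpha>X > 0 \<and> (c_VR G \<alpha>X \<alpha>Y 0 < Sep G \<alpha>X \<or> 2 * c_E G \<alpha>X \<alpha>Y 0 < Sep G \<alpha>X)
          \<longrightarrow> c_VR G \<alpha>X \<alpha>Y 0 = 2 * c_E G \<alpha>X \<alpha>Y 0)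
     \<and> (Sep G \<alpha>X > 0 \<and> Sep G \<alpha>Y > 0 \<longrightarrow>
          (\<forall>\<epsilon>::real. 0 < \<epsilon> \<and> ereal \<epsilon> \<le> Sep G \<alpha>Y / 2 \<longrightarrow>
             c_VR G \<alpha>X \<alpha>Y (2 * \<epsilon>) < Sep G \<alpha>X - ereal (2 * \<epsilon>)
               \<or> 2 * c_E G \<alpha>X \<alpha>Y \<epsilon> < Sep G \<alpha>X - ereal (2 * \<epsilon>)
             \<longrightarrow> c_VR G \<alpha>X \<alpha>Y (2 * \<epsilon>) = 2 * c_E G \<alpha>X \<alpha>Y \<epsilon>))"
proof -
  note lower = c_VR_le_c_infty[OF assms(2,3,4,5)]
  have "c_infty G \<alpha>X \<alpha>Y 0 = c_VR G \<alpha>X \<alpha>Y 0"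
    using c_infty_zero_le_c_VR_zero[OF assms(3)] lower by (rule order.antisym)
  moreover have "c_infty G \<alpha>X \<alpha>Y \<epsilon> \<le> (INF \<delta>\<in>{0<..}. c_VR G \<alpha>X \<alpha>Y (\<epsilon> + \<delta>) + ereal \<delta>)"
    if "0 < \<epsilon>" for \<epsilon>
    using c_infty_le_c_VR_shifted[OF assms(2,3,5,6) that] by (intro INF_greatest) simp
  moreover have double: "c_VR G \<alpha>X \<alpha>Y (2 * \<epsilon>) = 2 * c_E G \<alpha>X \<alpha>Y \<epsilon>" for \<epsilon>
    by (rule c_VR_double_eq_double_c_E[OF assms(2-6)])
  moreover have "c_VR G \<alpha>X \<alpha>Y 0 = 2 * c_E G \<alpha>X \<alpha>Y 0"
    using double[of 0] by simp
  ultimately show ?thesis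
    using lower by simp
qed

end
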